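(* Let $\mathcal{T}=\mathcal{T}(O)$ be a self-similar tiling generated on a feasible open set $O$ of an IFS $\{S_1,\dots,S_N\}$ in $\mathbb{R}^d$ with contraction ratios $r_1,\dots,r_N$ and similarity dimension $D$. Let $G$ be the generator of $\mathcal{T}$, $g$ its inradius and $T$ the union of the tiles. Assume that $\dim_M(\partial G,G)<D$. Then the $D$-dimensional average Minkowski content $\widetilde{\mathcal{M}}^D(\mathcal{T})$ of $\mathcal{T}$ exists, is strictly positive and is given by $$\widetilde{\mathcal{M}}^D(\mathcal{T})=\frac1\eta\int_0^g\varepsilon^{D-d-1}h(\varepsilon)\,d\varepsilon ,$$ where $\eta=-\sum_{i=1}^N r_i^D\ln r_i$ and $h:(0,\infty)\to\mathbb{R}$ is given by $$h(\varepsilon)=V(T,\varepsilon)-\sum_{i=1}^N\mathbf{1}_{(0,r_ig]}(\varepsilon)\,V(S_iT,\varepsilon).$$ If $\mathcal{T}$ is nonlattice, then also the Minkowski content $\mathcal{M}^D(\mathcal{T})$ exists and equals $\frac1\eta\int_0^g\varepsilon^{D-d-1}h(\varepsilon)\,d\varepsilon$.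
   Context: Setting. $N\ge2$, $S_1,\dots,S_N:\mathbb{R}^d\to\mathbb{R}^d$ are contracting similarities with ratios $r_i\in(0,1)$ (an IFS), and $\mathbf{S}(A):=\bigcup_{i=1}^N S_i(A)$. The similarity dimension $D$ is the unique real solution of $\sum_{i=1}^N r_i^D=1$. A feasible open set for the IFS is a nonempty bounded open set $O\subset\mathbb{R}^d$ with $S_iO\subset O$ for all $i$ and $S_iO\cap S_jO=\emptyset$ for $i\ne j$. The IFS (and the tiling) is called nonlattice if the additive subgroup of $\mathbb{R}$ generated by $\ln r_1,\dots,\ln r_N$ is not discrete. Tilings. Let $\Sigma_N^*=\bigcup_{n\ge0}\{1,\dots,N\}^n$ be the set of finite words, and for $\sigma=\sigma_1\cdots\sigma_n$ put $S_\sigma:=S_{\sigma_1}\circ\dots\circ S_{\sigma_n}$ (identity for the empty word). For a feasible open set $O$ let $K:=\overline O$ and let the generator be the open set $G:=O\setminus\mathbf{S}K$. The self-similar tiling generated on $O$ is $\mathcal{T}(O):=\{S_\sigma G:\sigma\in\Sigma_N^*\}$; its union set is $T:=\bigcup_{\sigma}S_\sigma G$. The tiling is only defined when $D<d$ (equivalently $G\neq\emptyset$), which is assumed. The inradius of $G$ is $g:=\sup\{d(x,\partial G):x\in G\}$. Minkowski contents. $\lambda_d$ is Lebesgue measure and $A_\varepsilon:=\{z:\inf_{a\in A}|a-z|\le\varepsilon\}$. For a bounded open set $U$, $V(U,\varepsilon):=\lambda_d(U_{-\varepsilon})$ with $U_{-\varepsilon}:=\{x\in U: d(x,\partial U)\le\varepsilon\}$.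 For bounded $A$ and $\Omega\subset\mathbb{R}^d$, the relative Minkowski content is $\mathcal{M}^s(A,\Omega):=\lim_{\varepsilon\searrow0}\varepsilon^{s-d}\lambda_d(A_\varepsilon\cap\Omega)$ and the average relative Minkowski content is $\widetilde{\mathcal{M}}^s(A,\Omega):=\lim_{\delta\searrow0}\frac1{|\ln\delta|}\int_\delta^1\varepsilon^{s-d}\lambda_d(A_\varepsilon\cap\Omega)\frac{d\varepsilon}{\varepsilon}$, whenever the limits exist. $\dim_M(A,\Omega)$ is the relative Minkowski dimension, i.e. $\inf\{s\ge0:\varepsilon^{s-d}\lambda_d(A_\varepsilon\cap\Omega)\to0 \text{ as }\varepsilon\searrow 0\}$; the condition $\dim_M(\partial G,G)<D$ is equivalent to the existence of constants $c,\gamma>0$ with $V(G,\varepsilon)\le c\,\varepsilon^{d-D+\gamma}$ for all $0<\varepsilon\le g$. For the tiling, $\mathcal{M}^D(\mathcal{T}):=\mathcal{M}^D(\partial T,T)=\lim_{\varepsilon\searrow0}\varepsilon^{D-d}V(T,\varepsilon)$ and $\widetilde{\mathcal{M}}^D(\mathcal{T}):=\widetilde{\mathcal{M}}^D(\partial T,T)$. *)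

theory Defs
  imports "HOL-Analysis.Analysis" "HOL-Computational_Algebra.Group_Closure"
begin

definition similarity :: "real \<Rightarrow> ('a::euclidean_space \<Rightarrow> 'a) \<Rightarrow> bool" where
  "similarity \<rho> f \<longleftrightarrow> (\<forall>x y. dist (f x) (f y) = \<rho> * dist x y)"

text \<open>Maps and ratios are indexed by \<open>{1..N}\<close>; values at other indices are irrelevant.\<close>

definition IFS :: "nat \<Rightarrow> (nat \<Rightarrow> 'a::euclidean_space \<Rightarrow> 'a) \<Rightarrow> (nat \<Rightarrow> real) \<Rightarrow> bool" where
  "IFS N S r \<longleftrightarrow> 2 \<le> N \<and> (\<forall>i\<in>{1..N}. 0 < r i \<and> r i < 1 \<and> similarity (r i) (S i))"

definition similarity_dim :: "nat \<Rightarrow> (nat \<Rightarrow> real) \<Rightarrow> real" where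
  "similarity_dim N r = (THE s. (\<Sum>i=1..N. r i powr s) = 1)"

definition feasible_open_set ::
    "nat \<Rightarrow> (nat \<Rightarrow> 'a::euclidean_space \<Rightarrow> 'a) \<Rightarrow> 'a set \<Rightarrow> bool" where
  "feasible_open_set N S U \<longleftrightarrow>
     U \<noteq> {} \<and> bounded U \<and> open U \<and>
     (\<forall>i\<in>{1..N}. S i ` U \<subseteq> U) \<and>
     (\<forall>i\<in>{1..N}. \<forall>j\<in>{1..N}. i \<noteq> j \<longrightarrow> S i ` U \<inter> S j ` U = {})"

definition nonlattice :: "nat \<Rightarrow> (nat \<Rightarrow> real) \<Rightarrow> bool" where
  "nonlattice N r \<longleftrightarrow> \<not> discrete (group_closure ((\<lambda>i. ln (r i)) ` {1..N}))"

definition set_map ::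
    "nat \<Rightarrow> (nat \<Rightarrow> 'a::euclidean_space \<Rightarrow> 'a) \<Rightarrow> 'a set \<Rightarrow> 'a set" where
  "set_map N S A = (\<Union>i\<in>{1..N}. S i ` A)"

fun word_map :: "(nat \<Rightarrow> 'a \<Rightarrow> 'a) \<Rightarrow> nat list \<Rightarrow> 'a \<Rightarrow> 'a" where
  "word_map S [] = id"
| "word_map S (i # \<sigma>) = S i \<circ> word_map S \<sigma>"

definition generator ::
    "nat \<Rightarrow> (nat \<Rightarrow> 'a::euclidean_space \<Rightarrow> 'a) \<Rightarrow> 'a set \<Rightarrow> 'a set" where
  "generator N S U = U - set_map N S (closure U)"

definition self_similar_tiling ::
    "nat \<Rightarrow> (nat \<Rightarrow> 'a::euclidean_space \<Rightarrow> 'a) \<Rightarrow> 'a set \<Rightarrow> 'a set set" where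
  "self_similar_tiling N S U = (\<lambda>\<sigma>. word_map S \<sigma> ` generator N S U) ` lists {1..N}"

definition inradius :: "'a::euclidean_space set \<Rightarrow> real" where
  "inradius G = (SUP x\<in>G. infdist x (frontier G))"

text \<open>The volume of the inner parallel set. For bounded \<open>U\<close>, the frontier is empty only if
  \<open>U\<close> is empty, so the convention \<open>infdist x {} = 0\<close> plays no role.\<close>

definition inner_volume :: "'a::euclidean_space set \<Rightarrow> real \<Rightarrow> real" where
  "inner_volume U \<epsilon> = measure lebesgue {x \<in> U. infdist x (frontier U) \<le> \<epsilon>}"

text \<open>The guard gives the empty set for \<open>A = {}\<close> (infimum \<open>\<infinity>\<close>), whereas \<open>infdist z {} = 0\<close>.\<close>

definition parallel_set :: "'a::euclidean_space set \<Rightarrow> real \<Rightarrow> 'a set" where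
  "parallel_set A \<epsilon> = {z. A \<noteq> {} \<and> infdist z A \<le> \<epsilon>}"

definition scaled_volume ::
    "real \<Rightarrow> 'a::euclidean_space set \<Rightarrow> 'a set \<Rightarrow> real \<Rightarrow> real" where
  "scaled_volume s A \<Omega> \<epsilon> =
     \<epsilon> powr (s - real DIM('a)) * measure lebesgue (parallel_set A \<epsilon> \<inter> \<Omega>)"

definition has_minkowski_content ::
    "real \<Rightarrow> 'a::euclidean_space set \<Rightarrow> 'a set \<Rightarrow> real \<Rightarrow> bool" where
  "has_minkowski_content s A \<Omega> M \<longleftrightarrow> (scaled_volume s A \<Omega> \<longlongrightarrow> M) (at_right 0)"

definition has_average_minkowski_content ::
    "real \<Rightarrow> 'a::euclidean_space set \<Rightarrow> 'a set \<Rightarrow> real \<Rightarrow> bool" where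
  "has_average_minkowski_content s A \<Omega> M \<longleftrightarrow>
     ((\<lambda>\<delta>. 1 / \<bar>ln \<delta>\<bar> * (LINT \<epsilon>:{\<delta>..1}|lborel. scaled_volume s A \<Omega> \<epsilon> / \<epsilon>)) \<longlongrightarrow> M)
       (at_right 0)"

text \<open>For bounded \<open>\<Omega>\<close> every \<open>s > DIM('a)\<close> lies in the set below, so the real infimum is
  the true one.\<close>

definition rel_minkowski_dim :: "'a::euclidean_space set \<Rightarrow> 'a set \<Rightarrow> real" where
  "rel_minkowski_dim A \<Omega> = Inf {s. 0 \<le> s \<and> (scaled_volume s A \<Omega> \<longlongrightarrow> 0) (at_right 0)}"

end

theory Submission
  imports Defs
begin

text \<open>
  Put \<open>\<epsilon> = exp (- t)\<close> and rescale the volume of the inner parallel set of the tiling to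
  \<open>F t = \<epsilon> powr (D - d) * V(T, \<epsilon>)\<close>. The Minkowski content is the limit of \<open>F\<close> at infinity and the
  average content is the limit of its running means. The union \<open>T\<close> of the tiles is the disjoint
  union of the generator \<open>G\<close> and the \<open>N\<close> copies \<open>S i ` T\<close>, all of them open. For a point of one of
  these pieces the distances to the frontier of \<open>T\<close> and to the frontier of the piece agree, since a
  ball is connected; hence \<open>V(T, \<epsilon>)\<close> is the sum of the volumes of the pieces. As the copies
  scale by \<open>V(S i ` T, \<epsilon>) = r i ^ d * V(T, \<epsilon> / r i)\<close>, the function \<open>Z\<close> that agrees with \<open>F\<close> where
  \<open>\<epsilon> \<le> g\<close> and vanishes elsewhere satisfies the renewal equation
  \<open>Z t = z t + (\<Sum>i. p i * Z (t - a i))\<close> with weights \<open>p i = r i powr D\<close> of sum \<open>1\<close> and steps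
  \<open>a i = - ln (r i)\<close>. Here \<open>z\<close> is \<open>h\<close>, rescaled and truncated like \<open>Z\<close>, and \<open>\<eta>\<close> is the mean step.

  Everything then follows from two facts about this equation. Integrating it gives
  \<open>(\<Sum>i. p i * integral of Z over (t - a i, t]) \<longlongrightarrow> integral of z\<close>, so a limit of \<open>Z\<close>, in whatever sense
  it exists, can only be \<open>(integral of z) / \<eta>\<close>.

  \<^item> Running means: the cumulative integral of \<open>Z\<close>, minus a line of the expected slope, solves
    the recursion with an error that tends to \<open>0\<close>, and such functions grow sublinearly
    (\<open>average_tendsto\<close>).

  \<^item> Pointwise limit: if \<open>Z t\<close> is close to the upper limit \<open>L\<close> of \<open>Z\<close>, then so is every \<open>Z (t - a i)\<close>,
    because \<open>Z t\<close> is nearly the average of these values and none of them can exceed \<open>L\<close> by much.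
    Iterating, \<open>Z\<close> is near \<open>L\<close> at all \<open>t - s\<close> with \<open>s\<close> in a given finite set of sums of steps. If the
    steps generate a nondiscrete group, such sums form arbitrarily fine nets of long intervals.
    Between two points of a net \<open>Z\<close> is controlled by \<open>Z (t + s) \<le> exp (c * s) * Z t\<close>, which holds as
    \<open>V(T, \<epsilon>)\<close> is monotone in \<open>\<epsilon>\<close>. So \<open>Z\<close> is near \<open>L\<close> on a whole window, and comparison with the integrated
    equation bounds \<open>L\<close> by \<open>(integral of z) / \<eta>\<close>. The lower limit is treated in the same way
    (\<open>limit_if_steps_dense\<close>).

  The dimension hypothesis on the generator makes \<open>z\<close> decay exponentially, hence integrable. The
  limit is positive because \<open>z\<close> is nonnegative and \<open>h\<close> is at least the volume of a whole copy of
  \<open>T\<close> while \<open>r i * g < \<epsilon> \<le> g\<close>.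
\<close>

section \<open>Averages over finitely many steps\<close>


text \<open>The limit superior at infinity as a real number; the infimum is only meaningful for
  eventually bounded functions, and the two facts below are the form in which it is used.\<close>

definition upper_limit :: "(real \<Rightarrow> real) \<Rightarrow> real" where
  "upper_limit X = Inf {c. \<forall>\<^sub>F t in at_top. X t \<le> c}"

lemma
  fixes X :: "real \<Rightarrow> real"
  assumes bdd: "\<forall>\<^sub>F t in at_top. \<bar>X t\<bar> \<le> C" and \<kappa>: "0 < \<kappa>"
  shows eventually_le_upper_limit: "\<forall>\<^sub>F t in at_top. X t \<le> upper_limit X + \<kappa>"
    and frequently_gt_upper_limit: "\<exists>\<^sub>F t in at_top. upper_limit X - \<kappa> < X t"
proof -
  define P where "P = {c. \<forall>\<^sub>F t in at_top. X t \<le> c}"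
  have L: "upper_limit X = Inf P" by (simp add: upper_limit_def P_def)
  have "C \<in> P" unfolding P_def using bdd by (auto elim: eventually_mono)
  have lb: "- C \<le> c" if "c \<in> P" for c
  proof -
    have "\<forall>\<^sub>F t in at_top. \<bar>X t\<bar> \<le> C \<and> X t \<le> c"
      using bdd that by (auto simp: P_def eventually_conj_iff)
    then obtain t where "\<bar>X t\<bar> \<le> C" "X t \<le> c"
      using eventually_happens'[OF trivial_limit_at_top_linorder] by blast
    then show ?thesis by simp
  qed
  then have bddP: "bdd_below P" by (auto simp: bdd_below_def)
  show "\<forall>\<^sub>F t in at_top. X t \<le> upper_limit X + \<kappa>"
  proof -
    obtain c where "c \<in> P" "c < upper_limit X + \<kappa>"
      using cInf_lessD[of P "upper_limit X + \<kappa>"] \<open>C \<in> P\<close> \<kappa> unfolding L by auto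
    then show ?thesis unfolding P_def by (auto elim: eventually_mono)
  qed
  show "\<exists>\<^sub>F t in at_top. upper_limit X - \<kappa> < X t"
  proof (rule ccontr)
    assume "\<not> ?thesis"
    then have "upper_limit X - \<kappa> \<in> P" by (auto simp: not_frequently not_less P_def)
    then have "upper_limit X \<le> upper_limit X - \<kappa>" using bddP unfolding L by (intro cInf_lower)
    with \<kappa> show False by simp
  qed
qed

text \<open>A probability distribution with finitely many positive steps \<open>a i\<close>, taken with
  probability \<open>p i\<close>.\<close>

locale step_distribution =
  fixes I :: "nat set" and p a :: "nat \<Rightarrow> real"
  assumes finite_I: "finite I"
    and p_pos: "i \<in> I \<Longrightarrow> 0 < p i"
    and a_pos: "i \<in> I \<Longrightarrow> 0 < a i"
    and p_sum: "(\<Sum>i\<in>I. p i) = 1"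
begin

definition mean_step :: real where
  "mean_step = (\<Sum>i\<in>I. p i * a i)"

lemma I_nonempty: "I \<noteq> {}"
  using p_sum by auto

lemma mean_step_pos: "0 < mean_step"
  unfolding mean_step_def using finite_I I_nonempty p_pos a_pos by (intro sum_pos) auto

lemma steps_bounded:
  obtains lo hi where "0 < lo" "0 < hi" "\<And>i. i \<in> I \<Longrightarrow> lo \<le> a i" "\<And>i. i \<in> I \<Longrightarrow> a i \<le> hi"
proof
  have ne: "a ` I \<noteq> {}" using I_nonempty by auto
  show "0 < Min (a ` I)" using finite_I ne a_pos by (subst Min_gr_iff) auto
  show "Min (a ` I) \<le> a i" "a i \<le> Max (a ` I)" if "i \<in> I" for i
    using that finite_I by (auto intro: Min_le Max_ge)
  obtain i where "i \<in> I" using I_nonempty by auto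
  then have "a i \<le> Max (a ` I)" using finite_I by (auto intro: Max_ge)
  then show "0 < Max (a ` I)" using a_pos[OF \<open>i \<in> I\<close>] by simp
qed

lemma weighted_average_const: "(\<Sum>i\<in>I. p i * c) = c"
  using p_sum by (simp add: sum_distrib_right[symmetric])

lemma weighted_average_affine: "(\<Sum>i\<in>I. p i * (B + c * (t - a i))) = B + c * t - c * mean_step"
proof -
  have "(\<Sum>i\<in>I. p i * (B + c * (t - a i))) = (\<Sum>i\<in>I. p i * (B + c * t) - c * (p i * a i))"
    by (intro sum.cong) (auto simp: algebra_simps)
  also have "\<dots> = (B + c * t) - c * mean_step"
    by (simp add: sum_subtractf weighted_average_const mean_step_def sum_distrib_left)
  finally show ?thesis by simp
qed

text \<open>Replacing \<open>q t\<close> by the average of the \<open>q (t - a i)\<close> moves back by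
  \<open>mean_step\<close> on average, so an error of \<open>c * mean_step\<close> per replacement adds
  up to a slope of at most \<open>c\<close>; here \<open>c\<close> is arbitrarily small.\<close>

lemma sublinear_if_recursion_error_vanishes:
  fixes q :: "real \<Rightarrow> real"
  assumes err: "((\<lambda>t. q t - (\<Sum>i\<in>I. p i * q (t - a i))) \<longlongrightarrow> 0) at_top"
    and bdd: "\<And>b. \<exists>B. \<forall>t\<in>{0..b}. \<bar>q t\<bar> \<le> B"
  shows "((\<lambda>t. q t / t) \<longlongrightarrow> 0) at_top"
proof (rule tendstoI)
  fix e :: real assume "0 < e"
  define c where "c = e / 2"
  have c: "0 < c" using \<open>0 < e\<close> by (simp add: c_def)
  obtain lo hi where lo: "0 < lo" "\<And>i. i \<in> I \<Longrightarrow> lo \<le> a i" and hi: "\<And>i. i \<in> I \<Longrightarrow> a i \<le> hi"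
    using steps_bounded by metis
  have "\<forall>\<^sub>F t in at_top. \<bar>q t - (\<Sum>i\<in>I. p i * q (t - a i))\<bar> < c * mean_step"
    using tendstoD[OF err, of "c * mean_step"] c mean_step_pos by (simp add: dist_real_def)
  then obtain t1 where t1: "\<And>t. t1 \<le> t \<Longrightarrow> \<bar>q t - (\<Sum>i\<in>I. p i * q (t - a i))\<bar> < c * mean_step"
    by (auto simp: eventually_at_top_linorder)
  define t0 where "t0 = max t1 (max hi 0)"
  obtain B where B: "\<And>t. t \<in> {0..t0} \<Longrightarrow> \<bar>q t\<bar> \<le> B"
    using bdd by blast
  \<comment> \<open>The line \<open>B + c t\<close> dominates \<open>\<bar>q\<bar>\<close> up to \<open>t0\<close>, and one application of the recursion
    carries the bound forward by \<open>lo\<close>: averaging the line over the steps lowers it by exactly the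
    error \<open>c * mean_step\<close> that the recursion may add.\<close>
  have step: "\<bar>q t\<bar> \<le> B + c * t" if "0 \<le> t" "t \<le> t0 + real n * lo" for n t
    using that
  proof (induction n arbitrary: t)
    case 0
    then have "\<bar>q t\<bar> \<le> B" by (intro B) auto
    with c 0 show ?case by (smt (verit) mult_nonneg_nonneg)
  next
    case (Suc n)
    show ?case
    proof (cases "t \<le> t0")
      case True
      then have "\<bar>q t\<bar> \<le> B" using Suc by (intro B) auto
      with c Suc show ?thesis by (smt (verit) mult_nonneg_nonneg)
    next
      case False
      have "\<bar>q (t - a i)\<bar> \<le> B + c * (t - a i)" if i: "i \<in> I" for i
      proof (rule Suc.IH)
        show "0 \<le> t - a i" using False hi[OF i] by (simp add: t0_def)
        show "t - a i \<le> t0 + real n * lo" using Suc.prems lo(2)[OF i] by (simp add: algebra_simps)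
      qed
      then have "\<bar>p i * q (t - a i)\<bar> \<le> p i * (B + c * (t - a i))" if "i \<in> I" for i
        using p_pos[OF that] that by (simp add: abs_mult)
      then have "\<bar>\<Sum>i\<in>I. p i * q (t - a i)\<bar> \<le> (\<Sum>i\<in>I. p i * (B + c * (t - a i)))"
        by (intro order_trans[OF sum_abs] sum_mono) auto
      also have "\<dots> = B + c * t - c * mean_step" by (rule weighted_average_affine)
      finally have "\<bar>\<Sum>i\<in>I. p i * q (t - a i)\<bar> \<le> B + c * t - c * mean_step" .
      moreover have "t1 \<le> t" using False by (simp add: t0_def)
      ultimately show ?thesis using t1[of t] by linarith
    qed
  qed
  have all: "\<bar>q t\<bar> \<le> B + c * t" if t: "0 \<le> t" for t
  proof -
    obtain n where "(t - t0) / lo \<le> real n" using real_arch_simple by blast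
    then have "t \<le> t0 + real n * lo" using lo(1) by (simp add: field_simps)
    with step t show ?thesis by blast
  qed
  show "\<forall>\<^sub>F t in at_top. dist (q t / t) 0 < e"
    using eventually_gt_at_top[of 0] eventually_gt_at_top[of "B / c"]
  proof eventually_elim
    case (elim t)
    then have "B < c * t" using c by (simp add: field_simps)
    then have "\<bar>q t\<bar> < e * t" using all[of t] elim by (simp add: c_def)
    then show ?case using elim by (simp add: dist_real_def field_simps)
  qed
qed

text \<open>The additive monoid generated by the steps: the distances by which iterating the average
  looks back.\<close>

inductive_set reachable :: "real set" where
  reachable_zero: "0 \<in> reachable"
| reachable_step: "s \<in> reachable \<Longrightarrow> i \<in> I \<Longrightarrow> s + a i \<in> reachable"

lemma reachable_add:
  assumes "s \<in> reachable" "u \<in> reachable"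
  shows "s + u \<in> reachable"
  using assms(2,1)
proof (induction rule: reachable.induct)
  case (reachable_step u i)
  then have "(s + u) + a i \<in> reachable" by (intro reachable.reachable_step) auto
  then show ?case by (simp add: add.assoc)
qed simp

lemma reachable_multiple: "s \<in> reachable \<Longrightarrow> real n * s \<in> reachable"
  by (induction n) (auto simp: algebra_simps intro: reachable_add reachable_zero)

text \<open>Collecting positive and negative coefficients separately writes an element of the group
  generated by the steps as a difference of two elements of the monoid.\<close>

lemma group_closure_reachable_diff:
  assumes "x \<in> group_closure (a ` I)"
  obtains u v where "u \<in> reachable" "v \<in> reachable" "x = u - v"
proof -
  have "\<exists>u\<in>reachable. \<exists>v\<in>reachable. x = u - v"
    using assms
  proof (induction rule: group_closure.induct)
    case (base s)
    then show ?case
      using reachable_zero reachable_step[OF reachable_zero] by force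
  next
    case (diff s t)
    then obtain u v u' v' where "u \<in> reachable" "v \<in> reachable" "s = u - v"
        "u' \<in> reachable" "v' \<in> reachable" "t = u' - v'" by blast
    then show ?case
      by (intro bexI[of _ "u + v'"] bexI[of _ "v + u'"]) (auto intro: reachable_add)
  qed
  then show thesis using that by blast
qed

text \<open>A nondiscrete group of reals has elements \<open>\<theta> > 0\<close> below every bound.
  Writing \<open>\<theta> = u - v\<close> with \<open>u\<close> and \<open>v\<close> reachable, the
  progression of step \<open>\<theta>\<close> from \<open>k * v\<close> to \<open>k * u\<close> stays
  reachable, and \<open>k\<close> can be chosen to make it as long as desired.\<close>

lemma reachable_fine_progression:
  assumes "\<not> discrete (group_closure (a ` I))" and "0 < \<delta>"
  obtains s0 \<theta> k where "0 < \<theta>" "\<theta> < \<delta>" "len \<le> real k * \<theta>"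
    "\<And>j. j \<le> k \<Longrightarrow> s0 + real j * \<theta> \<in> reachable"
proof -
  let ?H = "group_closure (a ` I)"
  obtain x where x: "x \<in> ?H" "\<not> x isolated_in ?H"
    using assms(1) unfolding discrete_def by blast
  then obtain y where y: "y \<in> ?H" "y \<noteq> x" "dist y x < \<delta>"
    using \<open>0 < \<delta>\<close> by (auto simp: isolated_in_islimpt_iff islimpt_approachable)
  define \<theta> where "\<theta> = \<bar>y - x\<bar>"
  have \<theta>: "0 < \<theta>" "\<theta> < \<delta>" using y by (auto simp: \<theta>_def dist_real_def)
  have "\<theta> \<in> ?H" using x y by (auto simp: \<theta>_def abs_if intro: group_closure.diff)
  then obtain u v where uv: "u \<in> reachable" "v \<in> reachable" "\<theta> = u - v"
    by (rule group_closure_reachable_diff)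
  then have "u = v + \<theta>" by simp
  obtain k where "len / \<theta> \<le> real k" using real_arch_simple by blast
  then have k: "len \<le> real k * \<theta>" using \<theta> by (simp add: field_simps)
  have "real k * v + real j * \<theta> \<in> reachable" if "j \<le> k" for j
  proof -
    \<comment> \<open>Trade \<open>j\<close> of the \<open>k\<close> copies of \<open>v\<close> for copies of \<open>u = v + \<theta>\<close>.\<close>
    have "real k * v + real j * \<theta> = real (k - j) * v + real j * u"
      using that unfolding \<open>u = v + \<theta>\<close> by (simp add: of_nat_diff algebra_simps)
    then show ?thesis using uv by (auto intro: reachable_add reachable_multiple)
  qed
  with \<theta> k show thesis using that by blast
qed

text \<open>If an average of values that hardly exceed \<open>L\<close> is near \<open>L\<close>, then
  each value with positive weight is near \<open>L\<close>; the closeness deteriorates by the factor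
  \<open>1 / p i\<close>. Finitely many repetitions reach any given \<open>s\<close>.\<close>

lemma near_upper_limit_propagates:
  fixes X :: "real \<Rightarrow> real"
  assumes err: "((\<lambda>t. X t - (\<Sum>i\<in>I. p i * X (t - a i))) \<longlongrightarrow> 0) at_top"
    and ub: "\<And>\<kappa>. 0 < \<kappa> \<Longrightarrow> \<forall>\<^sub>F t in at_top. X t \<le> L + \<kappa>"
    and "s \<in> reachable" "0 < \<kappa>"
  shows "\<exists>\<kappa>0>0. \<forall>\<^sub>F t in at_top. L - \<kappa>0 < X t \<longrightarrow> L - \<kappa> < X (t - s)"
  using assms(3,4)
proof (induction arbitrary: \<kappa> rule: reachable.induct)
  case reachable_zero
  then show ?case by auto
next
  case (reachable_step s i)
  obtain hi where hi: "\<And>i. i \<in> I \<Longrightarrow> a i \<le> hi" using steps_bounded by metis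
  define \<mu> where "\<mu> = p i * \<kappa> / 4"
  have pi: "0 < p i" "p i \<le> 1"
    using reachable_step.hyps p_pos p_sum finite_I member_le_sum[of i I p] by (auto intro: less_imp_le)
  have \<mu>: "0 < \<mu>" using pi reachable_step.prems by (simp add: \<mu>_def)
  obtain \<kappa>0 where \<kappa>0: "0 < \<kappa>0"
    "\<forall>\<^sub>F t in at_top. L - \<kappa>0 < X t \<longrightarrow> L - \<mu> < X (t - s)"
    using reachable_step.IH[OF \<mu>] by blast
  have "\<forall>\<^sub>F t in at_top. \<bar>X t - (\<Sum>i\<in>I. p i * X (t - a i))\<bar> < \<mu>"
    using tendstoD[OF err \<mu>] by (simp add: dist_real_def)
  then obtain t1 where t1: "\<And>t. t1 \<le> t \<Longrightarrow> \<bar>X t - (\<Sum>i\<in>I. p i * X (t - a i))\<bar> < \<mu>"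
    by (auto simp: eventually_at_top_linorder)
  obtain t2 where t2: "\<And>t. t2 \<le> t \<Longrightarrow> X t \<le> L + \<mu>"
    using ub[OF \<mu>] by (auto simp: eventually_at_top_linorder)
  have "\<forall>\<^sub>F t in at_top. L - \<kappa>0 < X t \<longrightarrow> L - \<kappa> < X (t - (s + a i))"
    using \<kappa>0(2) eventually_ge_at_top[of "t1 + s"] eventually_ge_at_top[of "t2 + s + hi"]
  proof eventually_elim
    case (elim t)
    show ?case
    proof
      assume "L - \<kappa>0 < X t"
      then have 1: "L - \<mu> < X (t - s)" using elim by blast
      have 2: "X (t - s - a j) \<le> L + \<mu>" if "j \<in> I" for j
        using elim hi[OF that] by (intro t2) auto
      \<comment> \<open>All terms of the average are at most \<open>L + \<mu>\<close>, so the one with weight \<open>p i\<close> cannot be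
        much below \<open>L\<close>.\<close>
      have "(\<Sum>j\<in>I. p j * X (t - s - a j)) = p i * X (t - s - a i) + (\<Sum>j\<in>I-{i}. p j * X (t - s - a j))"
        using finite_I reachable_step.hyps by (simp add: sum.remove)
      also have "(\<Sum>j\<in>I-{i}. p j * X (t - s - a j)) \<le> (\<Sum>j\<in>I-{i}. p j * (L + \<mu>))"
        using 2 p_pos by (intro sum_mono mult_left_mono) (auto intro: less_imp_le)
      also have "\<dots> = (L + \<mu>) - p i * (L + \<mu>)"
        using finite_I reachable_step.hyps weighted_average_const[of "L + \<mu>"]
        by (simp add: sum.remove[of I i])
      finally have "L - 2 * \<mu> < p i * X (t - s - a i) + (L + \<mu>) - p i * (L + \<mu>)"
        using t1[of "t - s"] elim 1 by auto
      then have "0 < p i * (X (t - s - a i) - (L + \<mu>)) + 3 * \<mu>"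
        by (simp add: algebra_simps)
      also have "3 * \<mu> = p i * (3 * \<kappa> / 4)" by (simp add: \<mu>_def)
      finally have "0 < p i * (X (t - s - a i) - (L + \<mu>) + 3 * \<kappa> / 4)"
        by (simp add: algebra_simps)
      then have "0 < X (t - s - a i) - (L + \<mu>) + 3 * \<kappa> / 4" using pi by (simp add: zero_less_mult_iff)
      moreover have "0 < \<kappa>" using reachable_step.prems by simp
      ultimately show "L - \<kappa> < X (t - (s + a i))" using \<mu>
        by (simp add: diff_diff_eq)
    qed
  qed
  with \<kappa>0 show ?case by blast
qed

text \<open>The tolerances of finitely many \<open>s\<close> can be met at one and the same
  \<open>t\<close>.\<close>

lemma upper_limit_attained_along_reachable:
  fixes X :: "real \<Rightarrow> real"
  assumes err: "((\<lambda>t. X t - (\<Sum>i\<in>I. p i * X (t - a i))) \<longlongrightarrow> 0) at_top"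
    and bdd: "\<forall>\<^sub>F t in at_top. \<bar>X t\<bar> \<le> C"
    and \<kappa>: "0 < \<kappa>" and A: "finite A" "A \<subseteq> reachable"
  shows "\<exists>\<^sub>F t in at_top. \<forall>s\<in>A. upper_limit X - \<kappa> < X (t - s)"
proof -
  let ?L = "upper_limit X"
  have "\<forall>s\<in>A. \<exists>\<kappa>0>0. \<forall>\<^sub>F t in at_top. ?L - \<kappa>0 < X t \<longrightarrow> ?L - \<kappa> < X (t - s)"
    using near_upper_limit_propagates[OF err eventually_le_upper_limit[OF bdd] _ \<kappa>] A by blast
  then obtain f where f: "\<And>s. s \<in> A \<Longrightarrow> 0 < f s"
    "\<And>s. s \<in> A \<Longrightarrow> \<forall>\<^sub>F t in at_top. ?L - f s < X t \<longrightarrow> ?L - \<kappa> < X (t - s)" by metis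
  define m where "m = Min (insert 1 (f ` A))"
  have m: "0 < m" "\<And>s. s \<in> A \<Longrightarrow> m \<le> f s"
    unfolding m_def using A f by (auto simp: Min_gr_iff)
  have "\<forall>\<^sub>F t in at_top. \<forall>s\<in>A. ?L - f s < X t \<longrightarrow> ?L - \<kappa> < X (t - s)"
    using A f by (intro eventually_ball_finite) auto
  then have "\<forall>\<^sub>F t in at_top. ?L - m < X t \<longrightarrow> (\<forall>s\<in>A. ?L - \<kappa> < X (t - s))"
  proof eventually_elim
    case (elim t)
    then show ?case using m(2) by (meson diff_left_mono order.strict_trans1)
  qed
  with frequently_gt_upper_limit[OF bdd m(1)] show ?thesis by (rule frequently_rev_mp)
qed

text \<open>The progression read as a net: every point of a window of length \<open>len\<close> has a
  reachable point within \<open>\<delta>\<close> on either side. Both sides are needed because growth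
  bounds of the form \<open>Z (t + s) \<le> exp (c * s) * Z t\<close> only compare a value with earlier
  ones.\<close>

lemma reachable_fine_net:
  assumes "\<not> discrete (group_closure (a ` I))" and "0 < \<delta>"
  obtains s0 A where "finite A" "A \<subseteq> reachable"
    "\<And>y. 0 \<le> y \<Longrightarrow> y \<le> len \<Longrightarrow> \<exists>s\<in>A. s \<le> s0 + y \<and> s0 + y \<le> s + \<delta>"
    "\<And>y. 0 \<le> y \<Longrightarrow> y \<le> len \<Longrightarrow> \<exists>s\<in>A. s0 + y \<le> s \<and> s \<le> s0 + y + \<delta>"
proof -
  obtain s0 \<theta> k where \<theta>: "0 < \<theta>" "\<theta> < \<delta>" "len \<le> real k * \<theta>"
    and prog: "\<And>j. j \<le> k \<Longrightarrow> s0 + real j * \<theta> \<in> reachable"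
    using reachable_fine_progression[OF assms] by metis
  define A where "A = (\<lambda>j. s0 + real j * \<theta>) ` {..k}"
  have "\<exists>s\<in>A. s \<le> s0 + y \<and> s0 + y \<le> s + \<delta>" if y: "0 \<le> y" "y \<le> len" for y
  proof -
    define j where "j = nat \<lfloor>y / \<theta>\<rfloor>"
    have "0 \<le> y / \<theta>" using y \<theta> by simp
    then have j: "real j \<le> y / \<theta>" "y / \<theta> \<le> real j + 1"
      unfolding j_def by linarith+
    have "y / \<theta> \<le> real k" using y \<theta> by (simp add: field_simps)
    then have "j \<le> k" using j by linarith
    then have "s0 + real j * \<theta> \<in> A" by (auto simp: A_def)
    moreover have "real j * \<theta> \<le> y" "y \<le> real j * \<theta> + \<theta>" using j \<theta> by (simp_all add: field_simps)
    ultimately show ?thesis using \<theta> by (intro bexI[of _ "s0 + real j * \<theta>"]) auto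
  qed
  moreover have "\<exists>s\<in>A. s0 + y \<le> s \<and> s \<le> s0 + y + \<delta>" if y: "0 \<le> y" "y \<le> len" for y
  proof -
    define j where "j = nat \<lceil>y / \<theta>\<rceil>"
    have "0 \<le> y / \<theta>" using y \<theta> by simp
    then have j: "y / \<theta> \<le> real j" "real j \<le> y / \<theta> + 1"
      unfolding j_def by linarith+
    have "y / \<theta> \<le> real k" using y \<theta> by (simp add: field_simps)
    then have "j \<le> k" unfolding j_def by (simp add: nat_le_iff ceiling_le_iff)
    then have "s0 + real j * \<theta> \<in> A" by (auto simp: A_def)
    moreover have "y \<le> real j * \<theta>" "real j * \<theta> \<le> y + \<theta>" using j \<theta> by (simp_all add: field_simps)
    ultimately show ?thesis using \<theta> by (intro bexI[of _ "s0 + real j * \<theta>"]) auto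
  qed
  moreover have "finite A" "A \<subseteq> reachable" using prog by (auto simp: A_def)
  ultimately show thesis using that by blast
qed

end

text \<open>The renewal equation with nonnegative solution \<open>Z\<close> and source \<open>z\<close>.
  Integrability of \<open>Z\<close> on half-lines \<open>{..t}\<close> makes it possible to cumulate
  from minus infinity, so that a shift of \<open>Z\<close> is a shift of its cumulative
  integral.\<close>

locale renewal_equation = step_distribution +
  fixes Z z :: "real \<Rightarrow> real"
  assumes Z_nonneg: "0 \<le> Z t"
    and Z_integrable: "set_integrable lborel {..t} Z"
    and z_integrable: "integrable lborel z"
    and renewal: "Z t = z t + (\<Sum>i\<in>I. p i * Z (t - a i))"
begin

definition cumulative :: "real \<Rightarrow> real" where
  "cumulative t = (LINT u:{..t}|lborel. Z u)"

text \<open>The weighted sum of the integrals of \<open>Z\<close> over the windows \<open>{t - a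
  i<..t}\<close>. It is \<open>mean_step * c\<close> if \<open>Z\<close> has the constant value
  \<open>c\<close> there, so it measures the size of \<open>Z\<close> near \<open>t\<close>.\<close>

definition windowed :: "real \<Rightarrow> real" where
  "windowed t = (\<Sum>i\<in>I. p i * (cumulative t - cumulative (t - a i)))"

definition renewal_limit :: real where
  "renewal_limit = (LINT u|lborel. z u) / mean_step"

lemma integral_shifted:
  shows "set_integrable lborel {..t} (\<lambda>u. Z (u - c))"
    and "(LINT u:{..t}|lborel. Z (u - c)) = cumulative (t - c)"
proof -
  let ?f = "\<lambda>u. indicator {..t - c} u *\<^sub>R Z u"
  have shift: "?f (- c + 1 * u) = indicator {..t} u *\<^sub>R Z (u - c)" for u
    by (auto simp: indicator_def algebra_simps)
  have "integrable lborel ?f" using Z_integrable[of "t - c"] by (simp add: set_integrable_def)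
  then have "integrable lborel (\<lambda>u. ?f (- c + 1 * u))"
    by (rule lborel_integrable_real_affine) simp
  then show "set_integrable lborel {..t} (\<lambda>u. Z (u - c))"
    unfolding set_integrable_def shift .
  show "(LINT u:{..t}|lborel. Z (u - c)) = cumulative (t - c)"
    using lborel_integral_real_affine[of 1 ?f "- c"] unfolding shift
    by (simp add: cumulative_def set_lebesgue_integral_def)
qed

text \<open>The integrated renewal equation: integrating \<open>Z (u - a i)\<close> up to
  \<open>t\<close> gives the cumulative integral up to \<open>t - a i\<close>. It shows that
  \<open>windowed\<close> converges, whether or not \<open>Z\<close> does.\<close>

lemma windowed_eq: "windowed t = (LINT u:{..t}|lborel. z u)"
proof -
  have z: "z = (\<lambda>u. Z u - (\<Sum>i\<in>I. p i * Z (u - a i)))"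
  proof
    show "z u = Z u - (\<Sum>i\<in>I. p i * Z (u - a i))" for u using renewal[of u] by linarith
  qed
  have int: "set_integrable lborel {..t} (\<lambda>u. p i * Z (u - a i))" for i
    using integral_shifted(1) by (rule set_integrable_mult_right)
  have sums: "set_integrable lborel {..t} (\<lambda>u. \<Sum>i\<in>I. p i * Z (u - a i))"
    "(LINT u:{..t}|lborel. (\<Sum>i\<in>I. p i * Z (u - a i))) = (\<Sum>i\<in>I. p i * cumulative (t - a i))"
  proof -
    show "set_integrable lborel {..t} (\<lambda>u. \<Sum>i\<in>I. p i * Z (u - a i))"
      using int unfolding set_integrable_def scaleR_sum_right
      by (intro Bochner_Integration.integrable_sum) auto
    have "(LINT u:{..t}|lborel. (\<Sum>i\<in>I. p i * Z (u - a i)))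
        = (\<Sum>i\<in>I. LINT u:{..t}|lborel. p i * Z (u - a i))"
      using int unfolding set_integrable_def set_lebesgue_integral_def scaleR_sum_right
      by (intro Bochner_Integration.integral_sum) auto
    then show "(LINT u:{..t}|lborel. (\<Sum>i\<in>I. p i * Z (u - a i))) = (\<Sum>i\<in>I. p i * cumulative (t - a i))"
      by (simp add: integral_shifted(2))
  qed
  have "(LINT u:{..t}|lborel. z u) = cumulative t - (\<Sum>i\<in>I. p i * cumulative (t - a i))"
    unfolding z cumulative_def[of t] sums(2)[symmetric]
    by (rule set_integral_diff(2)[OF Z_integrable sums(1)])
  also have "\<dots> = windowed t"
    by (simp add: windowed_def right_diff_distrib sum_subtractf weighted_average_const)
  finally show ?thesis by simp
qed

lemma windowed_tendsto: "(windowed \<longlongrightarrow> mean_step * renewal_limit) at_top"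
  using tendsto_integral_at_top[OF _ z_integrable] mean_step_pos
  unfolding windowed_eq[abs_def] set_lebesgue_integral_def renewal_limit_def by simp

lemma cumulative_diff:
  assumes "s \<le> t"
  shows "set_integrable lborel {s<..t} Z"
    and "cumulative t - cumulative s = (LINT u:{s<..t}|lborel. Z u)"
proof -
  show int: "set_integrable lborel {s<..t} Z"
    by (rule set_integrable_subset[OF Z_integrable[of t]]) auto
  have "{..t} = {..s} \<union> {s<..t}" using assms by auto
  then have "cumulative t = cumulative s + (LINT u:{s<..t}|lborel. Z u)"
    unfolding cumulative_def using Z_integrable[of s] int
    by (subst set_integral_Un[symmetric]) (auto simp: Int_def)
  then show "cumulative t - cumulative s = (LINT u:{s<..t}|lborel. Z u)" by simp
qed

lemma integral_const_interval:
  assumes "s \<le> t"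
  shows "set_integrable lborel {s<..t} (\<lambda>u. c :: real)" "(LINT u:{s<..t}|lborel. c) = (t - s) * c"
proof -
  show "set_integrable lborel {s<..t} (\<lambda>u. c :: real)"
    using assms unfolding set_integrable_def by (cases "c = 0") (auto simp: integrable_indicator_iff)
  show "(LINT u:{s<..t}|lborel. c) = (t - s) * c"
    using assms unfolding set_lebesgue_integral_def by simp
qed

lemma cumulative_diff_ge:
  assumes "s \<le> t" "\<And>u. s < u \<Longrightarrow> u \<le> t \<Longrightarrow> c \<le> Z u"
  shows "(t - s) * c \<le> cumulative t - cumulative s"
  unfolding cumulative_diff(2)[OF assms(1)] integral_const_interval(2)[OF assms(1), symmetric]
  using assms by (intro set_integral_mono cumulative_diff(1) integral_const_interval(1)) auto

lemma cumulative_diff_le: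
  assumes "s \<le> t" "\<And>u. s < u \<Longrightarrow> u \<le> t \<Longrightarrow> Z u \<le> c"
  shows "cumulative t - cumulative s \<le> (t - s) * c"
  unfolding cumulative_diff(2)[OF assms(1)] integral_const_interval(2)[OF assms(1), symmetric]
  using assms by (intro set_integral_mono cumulative_diff(1) integral_const_interval(1)) auto

lemma cumulative_mono: "s \<le> t \<Longrightarrow> cumulative s \<le> cumulative t"
  using cumulative_diff_ge[of s t 0] Z_nonneg by simp

lemma windowed_ge:
  assumes "\<And>i. i \<in> I \<Longrightarrow> a i \<le> hi" "\<And>u. t - hi \<le> u \<Longrightarrow> u \<le> t \<Longrightarrow> c \<le> Z u"
  shows "mean_step * c \<le> windowed t"
proof -
  have "a i * c \<le> cumulative t - cumulative (t - a i)" if "i \<in> I" for i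
    using cumulative_diff_ge[of "t - a i" t c] assms(1)[OF that] assms(2) a_pos[OF that] by auto
  then show ?thesis
    unfolding mean_step_def windowed_def sum_distrib_right mult.assoc
    using p_pos by (intro sum_mono mult_left_mono) (auto intro: less_imp_le)
qed

lemma windowed_le:
  assumes "\<And>i. i \<in> I \<Longrightarrow> a i \<le> hi" "\<And>u. t - hi \<le> u \<Longrightarrow> u \<le> t \<Longrightarrow> Z u \<le> c"
  shows "windowed t \<le> mean_step * c"
proof -
  have "cumulative t - cumulative (t - a i) \<le> a i * c" if "i \<in> I" for i
    using cumulative_diff_le[of "t - a i" t c] assms(1)[OF that] assms(2) a_pos[OF that] by auto
  then show ?thesis
    unfolding mean_step_def windowed_def sum_distrib_right mult.assoc
    using p_pos by (intro sum_mono mult_left_mono) (auto intro: less_imp_le)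
qed

text \<open>The cumulative integral minus the line of slope \<open>renewal_limit\<close> fulfils the
  recursion up to the error \<open>windowed t - mean_step * renewal_limit\<close>, which vanishes in the
  limit. It is therefore sublinear.\<close>

theorem average_tendsto: "((\<lambda>t. cumulative t / t) \<longlongrightarrow> renewal_limit) at_top"
proof -
  define q where "q t = cumulative t - renewal_limit * t" for t
  have "q t - (\<Sum>i\<in>I. p i * q (t - a i)) = windowed t - mean_step * renewal_limit" for t
  proof -
    have "(\<Sum>i\<in>I. p i * q (t - a i))
        = (\<Sum>i\<in>I. p i * cumulative (t - a i)) - (\<Sum>i\<in>I. p i * (0 + renewal_limit * (t - a i)))"
      by (simp add: q_def right_diff_distrib sum_subtractf)
    then show ?thesis
      unfolding weighted_average_affine
      by (simp add: q_def windowed_def right_diff_distrib sum_subtractf weighted_average_const)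
  qed
  then have err: "((\<lambda>t. q t - (\<Sum>i\<in>I. p i * q (t - a i))) \<longlongrightarrow> 0) at_top"
    using tendsto_diff[OF windowed_tendsto tendsto_const[of "mean_step * renewal_limit"]] by simp
  have "((\<lambda>t. q t / t) \<longlongrightarrow> 0) at_top"
  proof (rule sublinear_if_recursion_error_vanishes[OF err])
    fix b :: real
    have "\<bar>q t\<bar> \<le> \<bar>cumulative 0\<bar> + \<bar>cumulative b\<bar> + \<bar>renewal_limit\<bar> * \<bar>b\<bar>" if t: "t \<in> {0..b}" for t
    proof -
      have "cumulative 0 \<le> cumulative t" "cumulative t \<le> cumulative b"
        using t by (auto intro: cumulative_mono)
      moreover have "\<bar>renewal_limit * t\<bar> \<le> \<bar>renewal_limit\<bar> * \<bar>b\<bar>"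
        unfolding abs_mult using t by (intro mult_left_mono) auto
      ultimately show ?thesis unfolding q_def by linarith
    qed
    then show "\<exists>B. \<forall>t\<in>{0..b}. \<bar>q t\<bar> \<le> B" by blast
  qed
  then have "((\<lambda>t. q t / t + renewal_limit) \<longlongrightarrow> 0 + renewal_limit) at_top"
    by (intro tendsto_add tendsto_const)
  moreover have "\<forall>\<^sub>F t in at_top. q t / t + renewal_limit = cumulative t / t"
    using eventually_gt_at_top[of 0]
    by eventually_elim (simp add: q_def diff_divide_distrib)
  ultimately show ?thesis by (simp add: Lim_transform_eventually)
qed

text \<open>The one-sided growth bound carries values at the points of a fine net over to the gaps
  between them; it does the work of direct Riemann integrability in the classical renewal theorem. Near
  the upper limit \<open>L\<close>, a whole window of values is at least about \<open>L\<close>, so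
  \<open>mean_step * L\<close> is at most about \<open>windowed\<close>, whose limit is known; near the
  lower limit \<open>- l'\<close> the reverse inequality holds.\<close>

theorem limit_if_steps_dense:
  assumes dense: "\<not> discrete (group_closure (a ` I))"
    and z0: "(z \<longlongrightarrow> 0) at_top"
    and c: "0 \<le> c"
    and growth: "\<And>t s. t0 \<le> t \<Longrightarrow> 0 \<le> s \<Longrightarrow> Z (t + s) \<le> exp (c * s) * Z t"
  shows "(Z \<longlongrightarrow> renewal_limit) at_top"
proof -
  obtain hi where hi: "\<And>i. i \<in> I \<Longrightarrow> a i \<le> hi" using steps_bounded by metis
  have z_eq: "z = (\<lambda>t. Z t - (\<Sum>i\<in>I. p i * Z (t - a i)))"
  proof
    show "z t = Z t - (\<Sum>i\<in>I. p i * Z (t - a i))" for t using renewal[of t] by linarith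
  qed
  have err: "((\<lambda>t. Z t - (\<Sum>i\<in>I. p i * Z (t - a i))) \<longlongrightarrow> 0) at_top"
    using z0 by (simp only: z_eq)
  have err': "((\<lambda>t. - Z t - (\<Sum>i\<in>I. p i * - Z (t - a i))) \<longlongrightarrow> 0) at_top"
    using tendsto_minus[OF err] by (simp add: sum_negf)
  have growth': "Z v \<le> exp (c * \<delta>) * Z u" if "t0 \<le> u" "u \<le> v" "v \<le> u + \<delta>" for u v \<delta>
  proof -
    have "Z v \<le> exp (c * (v - u)) * Z u" using growth[of u "v - u"] that by simp
    also have "\<dots> \<le> exp (c * \<delta>) * Z u"
      using that c Z_nonneg by (intro mult_right_mono) (auto intro: mult_left_mono)
    finally show ?thesis .
  qed
  \<comment> \<open>A large value at \<open>t\<close> forces large values on the whole window before \<open>t\<close>, while \<open>windowed\<close> stays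
    bounded.\<close>
  have bdd: "\<forall>\<^sub>F t in at_top. \<bar>Z t\<bar> \<le> (mean_step * renewal_limit + 1) * exp (c * hi) / mean_step"
    using order_tendstoD(2)[OF windowed_tendsto, of "mean_step * renewal_limit + 1", simplified]
      eventually_ge_at_top[of "t0 + hi"]
  proof eventually_elim
    case (elim t)
    have "mean_step * (exp (- (c * hi)) * Z t) \<le> windowed t"
    proof (rule windowed_ge[OF hi])
      fix u assume "t - hi \<le> u" "u \<le> t"
      then have "Z t \<le> exp (c * hi) * Z u" using elim by (intro growth') auto
      then show "exp (- (c * hi)) * Z t \<le> Z u" by (simp add: exp_minus field_simps)
    qed
    then have "mean_step * (exp (- (c * hi)) * Z t) \<le> mean_step * renewal_limit + 1"
      using elim by simp
    then show ?case using mean_step_pos Z_nonneg[of t] by (simp add: exp_minus field_simps)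
  qed
  have shifted: "((\<lambda>t. windowed (t - s)) \<longlongrightarrow> mean_step * renewal_limit) at_top" for s
    using windowed_tendsto by (rule filterlim_compose)
      (use filterlim_tendsto_add_at_top[OF tendsto_const[of "-s"] filterlim_ident] in simp)
  have bdd': "\<forall>\<^sub>F t in at_top. \<bar>- Z t\<bar> \<le> (mean_step * renewal_limit + 1) * exp (c * hi) / mean_step"
    using bdd by simp
  define L where "L = upper_limit Z"
  define l' where "l' = upper_limit (\<lambda>t. - Z t)"
  note L = eventually_le_upper_limit[OF bdd, folded L_def]
    upper_limit_attained_along_reachable[OF err bdd, folded L_def]
  note l' = eventually_le_upper_limit[OF bdd', folded l'_def]
    upper_limit_attained_along_reachable[OF err' bdd', folded l'_def]
  \<comment> \<open>The parameter \<open>x\<close> serves as mesh of the net and as tolerance at its points.\<close>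
  have "mean_step * (exp (- (c * x)) * (L - x)) \<le> mean_step * renewal_limit" if x: "0 < x" for x
  proof (rule ccontr)
    assume contr: "\<not> ?thesis"
    obtain s0 A where A: "finite A" "A \<subseteq> reachable"
      "\<And>y. 0 \<le> y \<Longrightarrow> y \<le> hi \<Longrightarrow> \<exists>s\<in>A. s \<le> s0 + y \<and> s0 + y \<le> s + x"
      using reachable_fine_net[OF dense x] by metis
    have ev: "\<forall>\<^sub>F t in at_top. windowed (t - s0) < mean_step * (exp (- (c * x)) * (L - x))"
      using order_tendstoD(2)[OF shifted] contr by simp
    have "\<exists>\<^sub>F t in at_top. (\<forall>s\<in>A. L - x < Z (t - s)) \<and> t0 + s0 + hi \<le> t
        \<and> windowed (t - s0) < mean_step * (exp (- (c * x)) * (L - x))"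
      using L(2)[OF x A(1,2)] eventually_conj[OF eventually_ge_at_top[of "t0 + s0 + hi"] ev]
      by (rule frequently_eventually_frequently)
    then obtain t where t: "\<And>s. s \<in> A \<Longrightarrow> L - x < Z (t - s)" "t0 + s0 + hi \<le> t"
      "windowed (t - s0) < mean_step * (exp (- (c * x)) * (L - x))"
      using frequently_ex by blast
    have "mean_step * (exp (- (c * x)) * (L - x)) \<le> windowed (t - s0)"
    proof (rule windowed_ge[OF hi])
      fix u assume u: "t - s0 - hi \<le> u" "u \<le> t - s0"
      then obtain s where s: "s \<in> A" "s \<le> s0 + (t - s0 - u)" "s0 + (t - s0 - u) \<le> s + x"
        using A(3)[of "t - s0 - u"] by auto
      have "L - x \<le> Z (t - s)" using t(1)[OF s(1)] by simp
      also have "\<dots> \<le> exp (c * x) * Z u" using s u t by (intro growth') auto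
      finally show "exp (- (c * x)) * (L - x) \<le> Z u" by (simp add: exp_minus field_simps)
    qed
    with t(3) show False by simp
  qed
  then have up: "exp (- (c * x)) * (L - x) \<le> renewal_limit" if "0 < x" for x
    using that mean_step_pos by simp
  have "((\<lambda>x. exp (- (c * x)) * (L - x)) \<longlongrightarrow> exp (- (c * 0)) * (L - 0)) (at_right 0)"
    by (intro tendsto_intros)
  then have "exp (- (c * 0)) * (L - 0) \<le> renewal_limit"
    by (rule tendsto_upperbound) (auto simp: eventually_at_filter up)
  then have "L \<le> renewal_limit" by simp
  have "mean_step * renewal_limit \<le> mean_step * (exp (c * x) * (- l' + x))" if x: "0 < x" for x
  proof (rule ccontr)
    assume contr: "\<not> ?thesis"
    obtain s0 A where A: "finite A" "A \<subseteq> reachable"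
      "\<And>y. 0 \<le> y \<Longrightarrow> y \<le> hi \<Longrightarrow> \<exists>s\<in>A. s0 + y \<le> s \<and> s \<le> s0 + y + x"
      using reachable_fine_net[OF dense x] by metis
    have ev: "\<forall>\<^sub>F t in at_top. mean_step * (exp (c * x) * (- l' + x)) < windowed (t - s0)"
      using order_tendstoD(1)[OF shifted] contr by simp
    have "\<exists>\<^sub>F t in at_top. (\<forall>s\<in>A. l' - x < - Z (t - s)) \<and> t0 + s0 + hi + x \<le> t
        \<and> mean_step * (exp (c * x) * (- l' + x)) < windowed (t - s0)"
      using l'(2)[OF x A(1,2)] eventually_conj[OF eventually_ge_at_top[of "t0 + s0 + hi + x"] ev]
      by (rule frequently_eventually_frequently)
    then obtain t where t: "\<And>s. s \<in> A \<Longrightarrow> l' - x < - Z (t - s)" "t0 + s0 + hi + x \<le> t"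
      "mean_step * (exp (c * x) * (- l' + x)) < windowed (t - s0)"
      using frequently_ex by blast
    have "windowed (t - s0) \<le> mean_step * (exp (c * x) * (- l' + x))"
    proof (rule windowed_le[OF hi])
      fix u assume u: "t - s0 - hi \<le> u" "u \<le> t - s0"
      then obtain s where s: "s \<in> A" "s0 + (t - s0 - u) \<le> s" "s \<le> s0 + (t - s0 - u) + x"
        using A(3)[of "t - s0 - u"] by auto
      have "Z u \<le> exp (c * x) * Z (t - s)" using s u t by (intro growth') auto
      also have "\<dots> \<le> exp (c * x) * (- l' + x)" using t(1)[OF s(1)] by (intro mult_left_mono) auto
      finally show "Z u \<le> exp (c * x) * (- l' + x)" .
    qed
    with t(3) show False by simp
  qed
  then have low: "renewal_limit \<le> exp (c * x) * (- l' + x)" if "0 < x" for x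
    using that mean_step_pos by simp
  have "((\<lambda>x. exp (c * x) * (- l' + x)) \<longlongrightarrow> exp (c * 0) * (- l' + 0)) (at_right 0)"
    by (intro tendsto_intros)
  then have "renewal_limit \<le> exp (c * 0) * (- l' + 0)"
    by (rule tendsto_lowerbound) (use low in \<open>blast intro: eventually_mono[OF eventually_at_right_less]\<close>, simp)
  then have "renewal_limit \<le> - l'" by simp
  show ?thesis
  proof (rule tendstoI)
    fix e :: real assume e: "0 < e"
    show "\<forall>\<^sub>F t in at_top. dist (Z t) renewal_limit < e"
      using L(1)[OF half_gt_zero[OF e]] l'(1)[OF half_gt_zero[OF e]]
    proof eventually_elim
      case (elim t)
      then have "\<bar>Z t - renewal_limit\<bar> \<le> e / 2"
        using \<open>L \<le> renewal_limit\<close> \<open>renewal_limit \<le> - l'\<close> by linarith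
      then show ?case using e by (simp add: dist_real_def)
    qed
  qed
qed

end

section \<open>Similarities of Euclidean space\<close>

text \<open>Divided by \<open>\<rho>\<close> and normalised at \<open>0\<close>, a similarity is an
  isometry fixing \<open>0\<close>, hence orthogonal.\<close>

lemma similarity_affine:
  fixes f :: "'a::euclidean_space \<Rightarrow> 'a"
  assumes "similarity \<rho> f" "0 < \<rho>"
  obtains L where "linear L" "\<And>x. norm (L x) = \<rho> * norm x" "f = (\<lambda>x. f 0 + L x)"
proof
  define g where "g x = (1 / \<rho>) *\<^sub>R (f x - f 0)" for x
  have "dist (g x) (g y) = dist x y" for x y
  proof -
    have "g x - g y = (1 / \<rho>) *\<^sub>R (f x - f y)" by (simp add: g_def scaleR_diff_right)
    then have "dist (g x) (g y) = (1 / \<rho>) * dist (f x) (f y)"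
      using assms by (simp add: dist_norm)
    then show ?thesis using assms by (simp add: similarity_def)
  qed
  then have "orthogonal_transformation g"
    by (simp add: orthogonal_transformation_isometry g_def)
  then show "linear (\<lambda>x. \<rho> *\<^sub>R g x)" "\<And>x. norm (\<rho> *\<^sub>R g x) = \<rho> * norm x"
    using assms by (auto simp: orthogonal_transformation_linear orthogonal_transformation_norm
        intro: linear_compose_scale_right)
  show "f = (\<lambda>x. f 0 + \<rho> *\<^sub>R g x)"
    using assms by (auto simp: g_def)
qed

lemma scaled_isometry_bij:
  fixes L :: "'a::euclidean_space \<Rightarrow> 'a"
  assumes "linear L" "\<And>x. norm (L x) = \<rho> * norm x" "0 < \<rho>"
  shows "inj L" "surj L"
proof -
  have "L x = 0 \<Longrightarrow> x = 0" for x using assms(2)[of x] \<open>0 < \<rho>\<close> by simp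
  then show "inj L" using assms(1) by (simp add: linear_injective_0)
  then show "surj L" using assms(1) by (simp add: linear_injective_imp_surjective)
qed

lemma scaled_isometry_image_ball:
  fixes L :: "'a::euclidean_space \<Rightarrow> 'a"
  assumes "linear L" "\<And>x. norm (L x) = \<rho> * norm x" "0 < \<rho>"
  shows "L ` ball x e = ball (L x) (\<rho> * e)"
proof -
  have d: "dist (L x) (L y) = \<rho> * dist x y" for x y
    using assms(2)[of "x - y"] by (simp add: dist_norm linear_diff[OF assms(1)])
  have "y \<in> L ` ball x e" if y: "y \<in> ball (L x) (\<rho> * e)" for y
  proof -
    obtain z where "y = L z" using scaled_isometry_bij(2)[OF assms] by (metis surjD)
    then show ?thesis using y \<open>0 < \<rho>\<close> by (auto simp: d)
  qed
  then show ?thesis using \<open>0 < \<rho>\<close> by (auto simp: d)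
qed

text \<open>Scaled isometries map balls to balls, so on disjoint unions of balls the change of measure
  can be read off from the formula for the volume of a ball.\<close>

lemma emeasure_scaled_isometry_disjoint_balls:
  fixes L :: "'a::euclidean_space \<Rightarrow> 'a"
  assumes L: "linear L" "\<And>x. norm (L x) = \<rho> * norm x" "0 < \<rho>"
    and C: "countable C" "disjoint_family_on (\<lambda>i. ball (fst i) (snd i)) C" "\<And>i. i \<in> C \<Longrightarrow> 0 < snd i"
  shows "emeasure lebesgue (L ` (\<Union>i\<in>C. ball (fst i) (snd i)))
    = ennreal (\<rho> ^ DIM('a)) * emeasure lebesgue (\<Union>i\<in>C. ball (fst i) (snd i))"
proof -
  have im: "L ` (\<Union>i\<in>C. ball (fst i) (snd i)) = (\<Union>i\<in>C. ball (L (fst i)) (\<rho> * snd i))"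
    by (simp add: image_UN scaled_isometry_image_ball[OF L])
  have "disjoint_family_on (\<lambda>i. L ` ball (fst i) (snd i)) C"
    using C(2) scaled_isometry_bij(1)[OF L]
    by (auto simp: disjoint_family_on_def inj_image_eq_iff simp flip: image_Int)
  then have disj: "disjoint_family_on (\<lambda>i. ball (L (fst i)) (\<rho> * snd i)) C"
    by (simp add: scaled_isometry_image_ball[OF L])
  have ball: "emeasure lebesgue (ball (L (fst i)) (\<rho> * snd i))
      = ennreal (\<rho> ^ DIM('a)) * emeasure lebesgue (ball (fst i) (snd i))" if "i \<in> C" for i
    using C(3)[OF that] \<open>0 < \<rho>\<close>
    by (simp add: emeasure_ball power_mult_distrib ennreal_mult'[symmetric] algebra_simps)
  have "emeasure lebesgue (\<Union>i\<in>C. ball (L (fst i)) (\<rho> * snd i))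
      = (\<integral>\<^sup>+i. emeasure lebesgue (ball (L (fst i)) (\<rho> * snd i)) \<partial>count_space C)"
    using C(1) disj by (intro emeasure_UN_countable) auto
  also have "\<dots> = (\<integral>\<^sup>+i. ennreal (\<rho> ^ DIM('a)) * emeasure lebesgue (ball (fst i) (snd i)) \<partial>count_space C)"
    by (rule nn_integral_cong, rule ball) simp
  also have "\<dots> = ennreal (\<rho> ^ DIM('a)) * (\<integral>\<^sup>+i. emeasure lebesgue (ball (fst i) (snd i)) \<partial>count_space C)"
    by (intro nn_integral_cmult) auto
  also have "(\<integral>\<^sup>+i. emeasure lebesgue (ball (fst i) (snd i)) \<partial>count_space C)
      = emeasure lebesgue (\<Union>i\<in>C. ball (fst i) (snd i))"
    using C(1,2) by (intro emeasure_UN_countable[symmetric]) auto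
  finally show ?thesis by (simp only: im)
qed

text \<open>By Vitali's theorem a box is a countable disjoint union of balls up to a null set, and
  linear maps preserve null sets.\<close>

lemma measure_scaled_isometry_cbox:
  fixes L :: "'a::euclidean_space \<Rightarrow> 'a"
  assumes L: "linear L" "\<And>x. norm (L x) = \<rho> * norm x" "0 < \<rho>"
  shows "measure lebesgue (L ` cbox a b) = \<rho> ^ DIM('a) * measure lebesgue (cbox a b)"
proof -
  define K where "K = {i :: 'a \<times> real. 0 < snd i \<and> ball (fst i) (snd i) \<subseteq> box a b}"
  have fine: "\<exists>i. i \<in> K \<and> x \<in> ball (fst i) (snd i) \<and> snd i < d" if x: "x \<in> box a b" "0 < d" for x d
  proof -
    obtain e where e: "0 < e" "ball x e \<subseteq> box a b" using x open_box openE by blast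
    have "ball x (min e (d / 2)) \<subseteq> box a b" using e by (auto simp: subset_eq)
    then have "(x, min e (d / 2)) \<in> K" using e x by (simp add: K_def)
    then show ?thesis using e x by (intro exI[of _ "(x, min e (d / 2))"]) auto
  qed
  obtain C where C: "countable C" "C \<subseteq> K"
    "pairwise (\<lambda>i j. disjnt (ball (fst i) (snd i)) (ball (fst j) (snd j))) C"
    "negligible (box a b - (\<Union>i\<in>C. ball (fst i) (snd i)))"
    by (rule Vitali_covering_theorem_balls[of "box a b" K fst snd]) (use fine in blast)+
  let ?B = "\<Union>i\<in>C. ball (fst i) (snd i)"
  have sub: "?B \<subseteq> cbox a b" using C(2) box_subset_cbox by (fastforce simp: K_def)
  have "cbox a b - ?B \<subseteq> (cbox a b - box a b) \<union> (box a b - ?B)" by auto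
  moreover have "negligible (cbox a b - box a b)"
    by (simp add: negligible_frontier_interval)
  ultimately have neg: "negligible (cbox a b - ?B)"
    using C(4) by (meson negligible_Un negligible_subset)
  then have "negligible (L ` (cbox a b - ?B))"
    by (intro negligible_differentiable_image_negligible linear_imp_differentiable_on L(1)) auto
  then have negL: "negligible (L ` cbox a b - L ` ?B)"
    by (rule negligible_subset) auto
  have bB: "bounded ?B" using sub bounded_cbox by (rule bounded_subset[rotated])
  then have mB: "?B \<in> lmeasurable" by (intro lmeasurable_open) auto
  have "bounded (L ` ?B)" using bB L(1) by (intro bounded_linear_image) (simp_all add: linear_linear)
  moreover have "open (L ` ?B)" unfolding image_UN scaled_isometry_image_ball[OF L] by auto
  ultimately have mLB: "L ` ?B \<in> lmeasurable" by (rule lmeasurable_open)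
  have em: "emeasure lebesgue (L ` ?B) = ennreal (\<rho> ^ DIM('a)) * emeasure lebesgue ?B"
    using C by (intro emeasure_scaled_isometry_disjoint_balls[OF L])
      (auto simp: disjoint_family_on_def pairwise_def disjnt_def K_def)
  have "measure lebesgue (L ` cbox a b) = measure lebesgue (L ` ?B)"
  proof (rule measure_negligible_symdiff[OF mLB])
    have "L ` ?B - L ` cbox a b = {}" using sub by blast
    then show "negligible (L ` ?B - L ` cbox a b \<union> (L ` cbox a b - L ` ?B))" using negL by simp
  qed
  also have "\<dots> = \<rho> ^ DIM('a) * measure lebesgue ?B"
    unfolding measure_def em using \<open>0 < \<rho>\<close> by (simp add: enn2real_mult)
  also have "measure lebesgue ?B = measure lebesgue (cbox a b)"
  proof (rule measure_negligible_symdiff[OF mB, symmetric])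
    have "?B - cbox a b = {}" using sub by blast
    then show "negligible (?B - cbox a b \<union> (cbox a b - ?B))" using neg by simp
  qed
  finally show ?thesis .
qed

lemma
  fixes f :: "'a::euclidean_space \<Rightarrow> 'a"
  assumes f: "similarity \<rho> f" "0 < \<rho>" and A: "A \<in> lmeasurable"
  shows lmeasurable_similarity_image: "f ` A \<in> lmeasurable"
    and measure_similarity_image: "measure lebesgue (f ` A) = \<rho> ^ DIM('a) * measure lebesgue A"
proof -
  obtain L where L: "linear L" "\<And>x. norm (L x) = \<rho> * norm x" and fL: "f = (\<lambda>x. f 0 + L x)"
    using similarity_affine[OF f] by metis
  have im: "f ` A = (+) (f 0) ` L ` A" by (subst fL) (simp add: image_image)
  have "L ` A \<in> lmeasurable \<and> \<rho> ^ DIM('a) * measure lebesgue A = measure lebesgue (L ` A)"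
    using L f(2) A by (intro measure_linear_sufficient measure_scaled_isometry_cbox) auto
  then show "f ` A \<in> lmeasurable" "measure lebesgue (f ` A) = \<rho> ^ DIM('a) * measure lebesgue A"
    unfolding im by (simp_all add: measurable_translation measure_translation)
qed

lemma
  fixes f :: "'a::euclidean_space \<Rightarrow> 'a"
  assumes f: "similarity \<rho> f" "0 < \<rho>"
  shows closure_similarity_image: "closure (f ` A) = f ` closure A"
    and interior_similarity_image: "interior (f ` A) = f ` interior A"
    and frontier_similarity_image: "frontier (f ` A) = f ` frontier A"
proof -
  obtain L where L: "linear L" "\<And>x. norm (L x) = \<rho> * norm x" and fL: "f = (\<lambda>x. f 0 + L x)"
    using similarity_affine[OF f] by metis
  have inj: "inj L" by (rule scaled_isometry_bij(1)[OF L f(2)])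
  have im: "f ` B = (+) (f 0) ` L ` B" for B by (subst fL) (simp add: image_image)
  have "inj f" using inj by (subst fL) (auto simp: inj_def)
  show cl: "closure (f ` A) = f ` closure A"
    unfolding im closure_translation by (simp add: closure_injective_linear_image[OF L(1) inj])
  show int: "interior (f ` A) = f ` interior A"
    unfolding im interior_translation by (simp add: interior_injective_linear_image[OF L(1) inj])
  show "frontier (f ` A) = f ` frontier A"
    unfolding frontier_def cl int using \<open>inj f\<close> by (simp add: image_set_diff)
qed

lemma open_similarity_image:
  fixes f :: "'a::euclidean_space \<Rightarrow> 'a"
  assumes "similarity \<rho> f" "0 < \<rho>" "open A"
  shows "open (f ` A)"
  using interior_similarity_image[OF assms(1,2), of A] assms(3) by (metis interior_open open_interior)

lemma bounded_similarity_image: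
  fixes f :: "'a::euclidean_space \<Rightarrow> 'a"
  assumes "similarity \<rho> f" "0 < \<rho>" "bounded A"
  shows "bounded (f ` A)"
proof -
  obtain x e where e: "\<And>y. y \<in> A \<Longrightarrow> dist x y \<le> e" using assms(3) by (auto simp: bounded_def)
  have "dist (f x) y \<le> \<rho> * e" if "y \<in> f ` A" for y
    using that e assms(1,2) by (auto simp: similarity_def)
  then show ?thesis by (auto simp: bounded_def)
qed

lemma infdist_similarity_image:
  fixes f :: "'a::euclidean_space \<Rightarrow> 'a"
  assumes f: "similarity \<rho> f" "0 < \<rho>"
  shows "infdist (f x) (f ` A) = \<rho> * infdist x A"
proof (cases "A = {}")
  case False
  have d: "dist (f x) (f y) = \<rho> * dist x y" for y using f by (simp add: similarity_def)
  have "\<rho> * infdist x A \<le> infdist (f x) (f ` A)"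
    unfolding infdist_notempty[OF False] infdist_notempty[of "f ` A", simplified, OF False]
    using False f(2) by (intro cINF_greatest) (auto simp: d intro!: mult_left_mono cINF_lower bdd_belowI[of _ 0])
  moreover have "infdist (f x) (f ` A) / \<rho> \<le> infdist x A"
  proof -
    have "infdist (f x) (f ` A) / \<rho> \<le> dist x y" if "y \<in> A" for y
      using infdist_le[of "f y" "f ` A" "f x"] that f(2) by (simp add: d field_simps)
    then show ?thesis unfolding infdist_notempty[OF False] using False by (intro cINF_greatest) auto
  qed
  ultimately show ?thesis using f(2) by (simp add: field_simps)
qed (simp add: infdist_def)

section \<open>Inner parallel volume\<close>

lemma frontier_nonempty_if_bounded:
  fixes A :: "'a::euclidean_space set"
  assumes "bounded A" "A \<noteq> {}"
  shows "frontier A \<noteq> {}"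
  using assms not_bounded_UNIV frontier_not_empty by metis

text \<open>The distance to the frontier is the radius of the largest ball in \<open>A\<close>: a ball
  around a point of \<open>A\<close> that misses the frontier is connected and so stays inside
  \<open>A\<close>.\<close>

lemma le_infdist_frontier_iff:
  fixes A :: "'a::euclidean_space set"
  assumes "open A" "bounded A" "x \<in> A"
  shows "\<rho> \<le> infdist x (frontier A) \<longleftrightarrow> ball x \<rho> \<subseteq> A"
proof (cases "0 < \<rho>")
  case True
  have ne: "frontier A \<noteq> {}" using assms frontier_nonempty_if_bounded by blast
  show ?thesis
  proof
    assume le: "\<rho> \<le> infdist x (frontier A)"
    have "ball x \<rho> \<inter> frontier A = {}"
      using le infdist_le[of _ "frontier A" x] by fastforce
    moreover have "x \<in> ball x \<rho> \<inter> A" using True assms by simp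
    ultimately show "ball x \<rho> \<subseteq> A"
      using connected_Int_frontier[OF connected_ball, of x \<rho> A] by blast
  next
    assume sub: "ball x \<rho> \<subseteq> A"
    have "\<rho> \<le> dist x y" if "y \<in> frontier A" for y
    proof -
      have "y \<notin> A" using that assms(1) by (simp add: frontier_def interior_open)
      then show ?thesis using sub by (meson mem_ball not_less subsetD)
    qed
    then show "\<rho> \<le> infdist x (frontier A)"
      unfolding infdist_notempty[OF ne] by (intro cINF_greatest ne)
  qed
next
  case False
  then show ?thesis using infdist_nonneg[of x "frontier A"] by (auto simp: ball_empty)
qed

text \<open>A ball inside \<open>W\<close> is connected, so if its centre lies in \<open>A\<close> it
  cannot meet \<open>W - A\<close>.\<close>

lemma infdist_frontier_open_component:
  fixes A :: "'a::euclidean_space set"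
  assumes W: "open W" "bounded W" and A: "open A" "A \<subseteq> W" "open (W - A)" "x \<in> A"
  shows "infdist x (frontier W) = infdist x (frontier A)"
proof -
  have iff: "ball x \<rho> \<subseteq> W \<longleftrightarrow> ball x \<rho> \<subseteq> A" for \<rho>
  proof
    assume sub: "ball x \<rho> \<subseteq> W"
    show "ball x \<rho> \<subseteq> A"
    proof (cases "0 < \<rho>")
      case True
      then have "A \<inter> ball x \<rho> \<noteq> {}" using A(4) by auto
      then have "(W - A) \<inter> ball x \<rho> = {}"
        using connectedD[of "ball x \<rho>" A "W - A"] A sub by auto
      then show ?thesis using sub by auto
    qed (auto simp: ball_empty)
  qed (use A in blast)
  have "bounded A" using W A bounded_subset by blast
  then have "\<rho> \<le> infdist x (frontier W) \<longleftrightarrow> \<rho> \<le> infdist x (frontier A)" for \<rho>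
    using W A iff[of \<rho>] by (simp add: le_infdist_frontier_iff subset_iff)
  then show ?thesis by (meson order_antisym order_refl)
qed

lemma inner_set_lmeasurable:
  fixes A :: "'a::euclidean_space set"
  assumes "open A" "bounded A"
  shows "{x \<in> A. infdist x (frontier A) \<le> e} \<in> lmeasurable"
proof -
  have "closed {x. infdist x (frontier A) \<le> e}"
    by (intro closed_Collect_le continuous_intros)
  moreover have "{x \<in> A. infdist x (frontier A) \<le> e} = A \<inter> {x. infdist x (frontier A) \<le> e}" by auto
  ultimately show ?thesis
    using assms by (simp add: fmeasurable_Int_fmeasurable lmeasurable_open borel_closed)
qed

lemma inner_volume_nonneg: "0 \<le> inner_volume A e"
  by (simp add: inner_volume_def)

lemma inner_volume_mono:
  fixes A :: "'a::euclidean_space set"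
  assumes "open A" "bounded A" "d \<le> e"
  shows "inner_volume A d \<le> inner_volume A e"
  unfolding inner_volume_def using assms
  by (intro measure_mono_fmeasurable inner_set_lmeasurable fmeasurableD) auto

lemma inner_volume_le_measure:
  fixes A :: "'a::euclidean_space set"
  assumes "open A" "bounded A"
  shows "inner_volume A e \<le> measure lebesgue A"
  unfolding inner_volume_def using assms
  by (intro measure_mono_fmeasurable inner_set_lmeasurable fmeasurableD) (auto intro: lmeasurable_open)

lemma bdd_above_infdist_frontier:
  fixes A :: "'a::euclidean_space set"
  assumes "open A" "bounded A"
  shows "bdd_above ((\<lambda>x. infdist x (frontier A)) ` A)"
proof (cases "A = {}")
  case False
  then obtain y where y: "y \<in> frontier A" using frontier_nonempty_if_bounded assms by blast
  obtain e where e: "\<And>x. x \<in> A \<Longrightarrow> dist y x \<le> e"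
    using assms(2) by (auto simp: bounded_any_center[of A y])
  have "infdist x (frontier A) \<le> e" if "x \<in> A" for x
    using infdist_le[OF y, of x] e[OF that] by (simp add: dist_commute)
  then show ?thesis by (auto simp: bdd_above_def)
qed simp

lemma infdist_frontier_le_inradius:
  fixes A :: "'a::euclidean_space set"
  assumes "open A" "bounded A" "x \<in> A"
  shows "infdist x (frontier A) \<le> inradius A"
  unfolding inradius_def using assms by (intro cSUP_upper bdd_above_infdist_frontier)

lemma inradius_pos:
  fixes A :: "'a::euclidean_space set"
  assumes "open A" "bounded A" "A \<noteq> {}"
  shows "0 < inradius A"
proof -
  obtain x where x: "x \<in> A" using assms by blast
  then obtain e where "0 < e" "ball x e \<subseteq> A" using assms openE by blast
  then have "0 < infdist x (frontier A)" using le_infdist_frontier_iff[of A x e] assms x by auto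
  then show ?thesis using infdist_frontier_le_inradius[OF assms(1,2) x] by linarith
qed

lemma inner_volume_eq_measure:
  fixes A :: "'a::euclidean_space set"
  assumes "open A" "bounded A" "inradius A \<le> e"
  shows "inner_volume A e = measure lebesgue A"
proof -
  have "{x \<in> A. infdist x (frontier A) \<le> e} = A"
    using infdist_frontier_le_inradius[OF assms(1,2)] assms(3) by force
  then show ?thesis by (simp add: inner_volume_def)
qed

lemma inner_volume_similarity_image:
  fixes f :: "'a::euclidean_space \<Rightarrow> 'a"
  assumes f: "similarity \<rho> f" "0 < \<rho>" and A: "open A" "bounded A"
  shows "inner_volume (f ` A) e = \<rho> ^ DIM('a) * inner_volume A (e / \<rho>)"
proof -
  have "{y \<in> f ` A. infdist y (frontier (f ` A)) \<le> e} = f ` {x \<in> A. infdist x (frontier A) \<le> e / \<rho>}"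
    using f(2) by (auto simp: frontier_similarity_image[OF f] infdist_similarity_image[OF f] field_simps)
  then show ?thesis
    unfolding inner_volume_def by (simp add: measure_similarity_image[OF f inner_set_lmeasurable[OF A]])
qed

lemma inner_volume_disjoint_Union:
  fixes F :: "'i \<Rightarrow> 'a::euclidean_space set"
  assumes fin: "finite J" and F: "\<And>j. j \<in> J \<Longrightarrow> open (F j)" "\<And>j. j \<in> J \<Longrightarrow> bounded (F j)"
    and disj: "disjoint_family_on F J"
  shows "inner_volume (\<Union>j\<in>J. F j) e = (\<Sum>j\<in>J. inner_volume (F j) e)"
proof -
  let ?W = "\<Union>j\<in>J. F j"
  have W: "open ?W" "bounded ?W" using fin F by auto
  have eq: "infdist x (frontier ?W) = infdist x (frontier (F j))" if "j \<in> J" "x \<in> F j" for j x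
  proof (rule infdist_frontier_open_component[OF W])
    have "?W - F j = (\<Union>i\<in>J - {j}. F i)"
      using disj that by (auto simp: disjoint_family_on_def)
    then show "open (?W - F j)" using F by auto
  qed (use F that in auto)
  let ?E = "\<lambda>j. {x \<in> F j. infdist x (frontier (F j)) \<le> e}"
  have "{x \<in> ?W. infdist x (frontier ?W) \<le> e} = (\<Union>j\<in>J. ?E j)"
    using eq by force
  moreover have "measure lebesgue (\<Union>j\<in>J. ?E j) = (\<Sum>j\<in>J. measure lebesgue (?E j))"
  proof (rule measure_finite_Union[OF fin])
    show "disjoint_family_on ?E J" using disj by (auto simp: disjoint_family_on_def)
    show "?E ` J \<subseteq> sets lebesgue" using F inner_set_lmeasurable by (auto intro!: fmeasurableD)
    show "emeasure lebesgue (?E j) \<noteq> \<infinity>" if "j \<in> J" for j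
      using fmeasurableD2[OF inner_set_lmeasurable[OF F(1)[OF that] F(2)[OF that]], of e] by simp
  qed
  ultimately show ?thesis by (simp add: inner_volume_def)
qed

lemma measurable_inner_volume [measurable]:
  fixes A :: "'a::euclidean_space set"
  assumes "open A" "bounded A"
  shows "inner_volume A \<in> borel_measurable borel"
  using assms by (intro borel_measurable_mono) (auto simp: mono_def intro: inner_volume_mono)

lemma scaled_volume_eq_inner_volume:
  fixes A :: "'a::euclidean_space set"
  assumes "bounded A" "A \<noteq> {}"
  shows "scaled_volume s (frontier A) A e = e powr (s - real DIM('a)) * inner_volume A e"
proof -
  have "parallel_set (frontier A) e \<inter> A = {x \<in> A. infdist x (frontier A) \<le> e}"
    using frontier_nonempty_if_bounded[OF assms] by (auto simp: parallel_set_def)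
  then show ?thesis by (simp add: scaled_volume_def inner_volume_def)
qed

text \<open>As the relative dimension is an infimum, some exponent \<open>s\<close> below \<open>D\<close> already has vanishing
  content; its decay rate is what makes the integral of the generator's contribution converge.\<close>

lemma inner_volume_decay_from_dimension:
  fixes A :: "'a::euclidean_space set"
  assumes "open A" "bounded A" "A \<noteq> {}" and dim: "rel_minkowski_dim (frontier A) A < D"
  shows "\<exists>s<D. \<exists>\<epsilon>0>0. \<forall>e. 0 < e \<and> e < \<epsilon>0 \<longrightarrow> inner_volume A e \<le> e powr (real DIM('a) - s)"
proof -
  let ?P = "{s. 0 \<le> s \<and> (scaled_volume s (frontier A) A \<longlongrightarrow> 0) (at_right 0)}"
  have "real DIM('a) + 1 \<in> ?P"
  proof -
    have "((\<lambda>e. e * measure lebesgue A) \<longlongrightarrow> 0 * measure lebesgue A) (at_right 0)"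
      by (intro tendsto_intros)
    then have lim: "((\<lambda>e. e * measure lebesgue A) \<longlongrightarrow> 0) (at_right 0)" by simp
    have "(scaled_volume (real DIM('a) + 1) (frontier A) A \<longlongrightarrow> 0) (at_right 0)"
    proof (rule tendsto_sandwich[OF _ _ tendsto_const lim])
      show "\<forall>\<^sub>F e in at_right 0. 0 \<le> scaled_volume (real DIM('a) + 1) (frontier A) A e"
        by (simp add: scaled_volume_def)
      show "\<forall>\<^sub>F e in at_right 0. scaled_volume (real DIM('a) + 1) (frontier A) A e \<le> e * measure lebesgue A"
        using eventually_at_right_less[of 0]
      proof eventually_elim
        case (elim e)
        then show ?case
          using assms inner_volume_le_measure[OF assms(1,2), of e]
          by (simp add: scaled_volume_eq_inner_volume)
      qed
    qed
    then show ?thesis by simp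
  qed
  then obtain s where s: "s \<in> ?P" "s < D"
    using dim cInf_lessD[of ?P D] unfolding rel_minkowski_dim_def by blast
  then have "\<forall>\<^sub>F e in at_right 0. scaled_volume s (frontier A) A e < 1"
    by (intro order_tendstoD) auto
  then obtain \<epsilon>0 where \<epsilon>0: "0 < \<epsilon>0" "\<And>e. 0 < e \<Longrightarrow> e < \<epsilon>0 \<Longrightarrow> scaled_volume s (frontier A) A e < 1"
    by (auto simp: eventually_at_right_field)
  have "inner_volume A e \<le> e powr (real DIM('a) - s)" if e: "0 < e" "e < \<epsilon>0" for e
  proof -
    have "inner_volume A e = e powr (real DIM('a) - s) * (e powr (s - real DIM('a)) * inner_volume A e)"
      using e by (simp add: powr_add[symmetric] mult.assoc[symmetric])
    also have "\<dots> \<le> e powr (real DIM('a) - s) * 1"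
      using \<epsilon>0(2)[OF e] assms by (intro mult_left_mono) (auto simp: scaled_volume_eq_inner_volume)
    finally show ?thesis by simp
  qed
  then show ?thesis using s(2) \<epsilon>0(1) by blast
qed

section \<open>Similarity dimension and exponential substitution\<close>

text \<open>The sum decreases strictly and continuously from \<open>N > 1\<close> at \<open>0\<close> to
  the limit \<open>0\<close>.\<close>

lemma similarity_dim_ex1:
  fixes r :: "nat \<Rightarrow> real"
  assumes N: "2 \<le> N" and r: "\<And>i. i \<in> {1..N} \<Longrightarrow> 0 < r i \<and> r i < 1"
  shows "\<exists>!s. (\<Sum>i=1..N. r i powr s) = 1"
proof -
  define P where "P s = (\<Sum>i=1..N. r i powr s)" for s
  have decr: "P t < P s" if "s < t" for s t
    unfolding P_def using N r that by (intro sum_strict_mono) (auto intro!: powr_less_mono')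
  have P0: "1 < P 0"
  proof -
    have "P 0 = (\<Sum>i=1..N. 1)" unfolding P_def using r by (intro sum.cong) (auto simp: less_le)
    then show ?thesis using N by simp
  qed
  have "((\<lambda>s. r i powr s) \<longlongrightarrow> 0) at_top" if "i \<in> {1..N}" for i
  proof -
    have "filterlim (\<lambda>s. ln (r i) * s) at_bot at_top"
      using r[OF that] by (intro filterlim_tendsto_neg_mult_at_bot[OF tendsto_const _ filterlim_ident]) auto
    then have "((\<lambda>s. exp (ln (r i) * s)) \<longlongrightarrow> 0) at_top"
      by (rule filterlim_compose[OF exp_at_bot])
    then show ?thesis using r[OF that] by (simp add: powr_def mult.commute)
  qed
  then have "(P \<longlongrightarrow> (\<Sum>i=1..N. 0)) at_top" unfolding P_def by (intro tendsto_sum)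
  then have "\<forall>\<^sub>F s in at_top. P s < 1" by (intro order_tendstoD) auto
  then obtain b where b: "0 \<le> b" "P b < 1"
    by (metis eventually_at_top_linorder linear)
  have "continuous_on {0..b} P"
    unfolding P_def by (intro continuous_intros) (use r in fastforce)+
  then obtain s where s: "P s = 1"
    using IVT2'[of P b 1 0] b P0 by auto
  show "\<exists>!s. (\<Sum>i=1..N. r i powr s) = 1"
    unfolding P_def[symmetric] using s decr by (metis less_irrefl linorder_neqE)
qed

lemma
  fixes f :: "real \<Rightarrow> real"
  assumes meas: "f \<in> borel_measurable borel" "A \<in> sets borel" "(\<lambda>t. exp (- t)) ` A \<in> sets borel"
    and int: "set_integrable lborel A (\<lambda>t. exp (- t) * f (exp (- t)))"
  shows set_integrable_exp_substitution: "set_integrable lborel ((\<lambda>t. exp (- t)) ` A) f"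
    and set_integral_exp_substitution:
      "(LINT x:(\<lambda>t. exp (- t)) ` A|lborel. f x) = (LINT t:A|lborel. exp (- t) * f (exp (- t)))"
proof -
  let ?e = "\<lambda>t::real. exp (- t)"
  let ?F = "\<lambda>t. exp (- t) * f (exp (- t))"
  note [measurable] = meas
  have comp: "set_integrable lebesgue B g \<longleftrightarrow> set_integrable lborel B g"
    "(LINT x:B|lebesgue. g x) = (LINT x:B|lborel. g x)"
    if [measurable]: "g \<in> borel_measurable borel" "B \<in> sets borel" for g :: "real \<Rightarrow> real" and B
    unfolding set_integrable_def set_lebesgue_integral_def
    by (simp_all add: integrable_completion integral_completion)
  have F: "?F \<in> borel_measurable borel" by measurable
  have abs: "?F absolutely_integrable_on A"
    using int comp(1)[OF F meas(2)] by simp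
  have "(f absolutely_integrable_on ?e ` A \<and> integral (?e ` A) f = integral A ?F)"
  proof -
    have "(?e has_field_derivative - exp (- t)) (at t within A)" for t
      by (auto intro!: derivative_eq_intros)
    moreover have "inj_on ?e A" by (auto simp: inj_on_def)
    moreover have "A \<in> sets lebesgue" using meas(2) by simp
    ultimately show ?thesis
      using has_absolute_integral_change_of_variables_1'[of A ?e "\<lambda>t. - exp (- t)" f "integral A ?F"] abs
      by simp
  qed
  then have f: "f absolutely_integrable_on ?e ` A" and eq: "integral (?e ` A) f = integral A ?F"
    by auto
  show "set_integrable lborel (?e ` A) f"
    using f comp(1)[OF meas(1,3)] by simp
  show "(LINT x:?e ` A|lborel. f x) = (LINT t:A|lborel. ?F t)"
    using eq set_lebesgue_integral_eq_integral(2)[OF f] set_lebesgue_integral_eq_integral(2)[OF abs]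
    by (simp add: comp(2)[OF meas(1,3)] comp(2)[OF F meas(2)])
qed

lemma set_integrable_exp_decay:
  fixes c :: real
  assumes "0 < c"
  shows "set_integrable lborel {b..} (\<lambda>t. exp (- c * t))"
proof -
  have "(\<lambda>t. exp (- c * t)) absolutely_integrable_on {b..}"
    using integrable_on_exp_minus_to_infinity[OF assms] by (intro nonnegative_absolutely_integrable_1) auto
  then show ?thesis
    by (simp add: set_integrable_def integrable_completion)
qed

lemma bounded_measurable_set_integrable:
  fixes f :: "real \<Rightarrow> real"
  assumes "f \<in> borel_measurable borel" "A \<in> sets borel" "bounded A" "\<And>x. x \<in> A \<Longrightarrow> \<bar>f x\<bar> \<le> C"
  shows "set_integrable lborel A f"
proof (rule set_integrable_bound[of lborel A "\<lambda>_. C"])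
  show "set_integrable lborel A (\<lambda>_. C)"
    using assms(2,3)
    by (auto simp: set_integrable_def intro!: integrable_real_indicator emeasure_bounded_finite)
  show "set_borel_measurable lborel A f"
    using assms(1,2) by (simp add: set_borel_measurable_def)
  show "AE x in lborel. x \<in> A \<longrightarrow> norm (f x) \<le> norm C"
    using assms(4) by (intro AE_I2) (auto intro: order_trans[OF _ abs_ge_self])
qed

section \<open>The tiling and its generator\<close>

text \<open>The tiling generated on \<open>U\<close>, with the notation of the theorem: \<open>G\<close>
  is the generator, \<open>g\<close> its inradius and \<open>T\<close> the union of the tiles.\<close>

locale self_similar_tiling_system =
  fixes N :: nat and S :: "nat \<Rightarrow> 'a::euclidean_space \<Rightarrow> 'a" and r :: "nat \<Rightarrow> real"
    and U :: "'a set"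
  assumes ifs: "IFS N S r"
    and feasible: "feasible_open_set N S U"
    and dim_less: "similarity_dim N r < real DIM('a)"
begin

definition D :: real where "D = similarity_dim N r"

definition G :: "'a set" where "G = generator N S U"

definition T :: "'a set" where "T = \<Union> (self_similar_tiling N S U)"

definition g :: real where "g = inradius G"

definition h :: "real \<Rightarrow> real" where
  "h e = inner_volume T e - (\<Sum>i=1..N. indicator {0<..r i * g} e * inner_volume (S i ` T) e)"

lemma N_ge_2: "2 \<le> N"
  using ifs by (simp add: IFS_def)

lemma
  assumes "i \<in> {1..N}"
  shows r_pos: "0 < r i" and r_less_1: "r i < 1" and similarity_S: "similarity (r i) (S i)"
  using ifs assms by (auto simp: IFS_def)

lemma
  shows U_nonempty: "U \<noteq> {}" and bounded_U: "bounded U" and open_U: "open U"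
  using feasible by (auto simp: feasible_open_set_def)

lemma S_image_U: "i \<in> {1..N} \<Longrightarrow> S i ` U \<subseteq> U"
  using feasible by (auto simp: feasible_open_set_def)

lemma S_image_U_disjoint:
  "i \<in> {1..N} \<Longrightarrow> j \<in> {1..N} \<Longrightarrow> i \<noteq> j \<Longrightarrow> S i ` U \<inter> S j ` U = {}"
  using feasible by (simp add: feasible_open_set_def)

lemma sum_ratio_powr_D: "(\<Sum>i=1..N. r i powr D) = 1"
  using theI'[OF similarity_dim_ex1[OF N_ge_2, of r]] r_pos r_less_1
  by (simp add: D_def similarity_dim_def)

lemma closed_set_map: "closed (set_map N S (closure U))"
proof -
  have "closed (S i ` closure U)" if "i \<in> {1..N}" for i
    using closure_similarity_image[OF similarity_S[OF that] r_pos[OF that], of U]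
    by (metis closed_closure)
  then show ?thesis unfolding set_map_def by (intro closed_UN) auto
qed

lemma open_G: "open G"
  using open_U closed_set_map by (simp add: G_def generator_def open_Diff)

lemma G_subset_U: "G \<subseteq> U"
  by (auto simp: G_def generator_def)

lemma bounded_G: "bounded G"
  using G_subset_U bounded_U bounded_subset by blast

lemma open_word_map_image: "\<sigma> \<in> lists {1..N} \<Longrightarrow> open A \<Longrightarrow> open (word_map S \<sigma> ` A)"
proof (induction \<sigma>)
  case (Cons i \<sigma>)
  then have i: "i \<in> {1..N}" and "open (word_map S \<sigma> ` A)" by auto
  then have "open (S i ` word_map S \<sigma> ` A)"
    using open_similarity_image[OF similarity_S[OF i] r_pos[OF i]] by blast
  then show ?case by (simp add: image_comp)
qed simp

lemma word_map_image_U: "\<sigma> \<in> lists {1..N} \<Longrightarrow> word_map S \<sigma> ` U \<subseteq> U"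
proof (induction \<sigma>)
  case (Cons i \<sigma>)
  then have "word_map S \<sigma> ` U \<subseteq> U" "S i ` U \<subseteq> U" using S_image_U by auto
  then show ?case by (simp add: image_comp[symmetric]) blast
qed simp

lemma open_T: "open T"
  unfolding T_def self_similar_tiling_def G_def[symmetric]
  using open_word_map_image open_G by auto

lemma T_subset_U: "T \<subseteq> U"
  unfolding T_def self_similar_tiling_def G_def[symmetric]
  using word_map_image_U G_subset_U by blast

lemma bounded_T: "bounded T"
  using T_subset_U bounded_U bounded_subset by blast

text \<open>Words are empty or start with a letter \<open>i\<close>; the tiles of the words starting
  with \<open>i\<close> make up \<open>S i ` T\<close>.\<close>

lemma T_decomposition: "T = G \<union> (\<Union>i\<in>{1..N}. S i ` T)"
proof -
  have lists: "lists {1..N} = insert [] (\<Union>i\<in>{1..N}. (#) i ` lists {1..N})"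
  proof (rule set_eqI)
    show "\<sigma> \<in> lists {1..N} \<longleftrightarrow> \<sigma> \<in> insert [] (\<Union>i\<in>{1..N}. (#) i ` lists {1..N})" for \<sigma>
      by (cases \<sigma>) auto
  qed
  have T: "T = (\<Union>\<sigma>\<in>lists {1..N}. word_map S \<sigma> ` G)"
    by (auto simp: T_def self_similar_tiling_def G_def)
  show ?thesis
    by (subst T, subst lists, subst T) (auto simp: image_UN image_comp)
qed

lemma measure_closure_U_pos: "0 < measure lebesgue (closure U)"
proof -
  have "closure U \<in> lmeasurable" using bounded_U by (intro lmeasurable_compact) simp
  moreover have "\<not> negligible (closure U)"
    using open_not_negligible[OF open_U U_nonempty] closure_subset negligible_subset by blast
  ultimately show ?thesis
    by (metis measure_nonneg negligible_iff_measure order_le_less)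
qed

lemma sum_ratio_power_less_1: "(\<Sum>i=1..N. r i ^ DIM('a)) < 1"
proof -
  have "(\<Sum>i=1..N. r i ^ DIM('a)) < (\<Sum>i=1..N. r i powr D)"
  proof (rule sum_strict_mono)
    show "r i ^ DIM('a) < r i powr D" if "i \<in> {1..N}" for i
      using powr_less_mono'[OF r_pos[OF that] r_less_1[OF that], of D "real DIM('a)"]
        dim_less r_pos[OF that] by (simp add: D_def powr_realpow)
  qed (use N_ge_2 in auto)
  then show ?thesis by (simp only: sum_ratio_powr_D)
qed

text \<open>If \<open>G\<close> were empty, \<open>closure U\<close> would be covered by its
  \<open>N\<close> images, whose total volume is strictly smaller because \<open>D\<close> is less than
  the dimension. The volume of \<open>closure U\<close> is compared rather than that of
  \<open>U\<close>, as the frontier of \<open>U\<close> may have positive measure.\<close>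

lemma G_nonempty: "G \<noteq> {}"
proof
  let ?K = "closure U"
  assume "G = {}"
  then have "U \<subseteq> set_map N S ?K" by (auto simp: G_def generator_def)
  then have sub: "?K \<subseteq> (\<Union>i\<in>{1..N}. S i ` ?K)"
    using closure_minimal[OF _ closed_set_map] by (simp add: set_map_def)
  have K: "?K \<in> lmeasurable" using bounded_U by (intro lmeasurable_compact) simp
  have SK: "S i ` ?K \<in> lmeasurable" "measure lebesgue (S i ` ?K) = r i ^ DIM('a) * measure lebesgue ?K"
    if "i \<in> {1..N}" for i
    using lmeasurable_similarity_image measure_similarity_image similarity_S[OF that] r_pos[OF that] K
    by blast+
  have "measure lebesgue ?K \<le> measure lebesgue (\<Union>i\<in>{1..N}. S i ` ?K)"
    using sub K SK by (intro measure_mono_fmeasurable fmeasurable.finite_UN fmeasurableD) auto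
  also have "\<dots> \<le> (\<Sum>i=1..N. measure lebesgue (S i ` ?K))"
    using SK by (intro measure_UNION_le) (auto intro: fmeasurableD)
  also have "\<dots> = (\<Sum>i=1..N. r i ^ DIM('a)) * measure lebesgue ?K"
    using SK(2) by (simp add: sum_distrib_right)
  also have "\<dots> < 1 * measure lebesgue ?K"
    using sum_ratio_power_less_1 measure_closure_U_pos by (intro mult_strict_right_mono)
  finally show False by simp
qed

lemma g_pos: "0 < g"
  unfolding g_def using open_G bounded_G G_nonempty by (rule inradius_pos)

lemma T_nonempty: "T \<noteq> {}"
  using G_nonempty T_decomposition by blast

lemma measure_T_pos: "0 < measure lebesgue T"
proof -
  have "\<not> negligible T" using open_not_negligible[OF open_T T_nonempty] .
  moreover have "T \<in> lmeasurable" using bounded_T open_T by (rule lmeasurable_open)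
  ultimately show ?thesis by (metis measure_nonneg negligible_iff_measure order_le_less)
qed

text \<open>The generator and the copies of \<open>T\<close> as one family; the index \<open>0\<close>
  stands for the generator.\<close>

definition piece :: "nat \<Rightarrow> 'a set" where
  "piece j = (if j = 0 then G else S j ` T)"

lemma T_eq_pieces: "T = (\<Union>j\<in>{0..N}. piece j)"
proof -
  have "{0..N} = insert 0 {1..N}" by auto
  then have "(\<Union>j\<in>{0..N}. piece j) = piece 0 \<union> (\<Union>j\<in>{1..N}. piece j)" by simp
  also have "(\<Union>j\<in>{1..N}. piece j) = (\<Union>j\<in>{1..N}. S j ` T)"
    by (intro SUP_cong) (auto simp: piece_def)
  finally show ?thesis using T_decomposition by (simp add: piece_def)
qed

lemma open_piece: "j \<in> {0..N} \<Longrightarrow> open (piece j)"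
  using open_G open_T by (auto simp: piece_def intro!: open_similarity_image[OF similarity_S r_pos])

lemma bounded_piece: "j \<in> {0..N} \<Longrightarrow> bounded (piece j)"
  using bounded_G bounded_T by (auto simp: piece_def intro!: bounded_similarity_image[OF similarity_S r_pos])

lemma disjoint_pieces: "disjoint_family_on piece {0..N}"
proof -
  have G: "G \<inter> S j ` T = {}" if "j \<in> {1..N}" for j
  proof -
    have "S j ` T \<subseteq> S j ` closure U" using T_subset_U closure_subset[of U] by blast
    also have "\<dots> \<subseteq> set_map N S (closure U)" using that by (auto simp: set_map_def)
    finally show ?thesis by (auto simp: G_def generator_def)
  qed
  have "S i ` T \<inter> S j ` T = {}" if "i \<in> {1..N}" "j \<in> {1..N}" "i \<noteq> j" for i j
    using S_image_U_disjoint[OF that] T_subset_U by blast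
  moreover have "S j ` T \<inter> G = {}" if "j \<in> {1..N}" for j using G[OF that] by blast
  ultimately show ?thesis using G by (simp add: disjoint_family_on_def piece_def)
qed

lemma infdist_frontier_T_piece:
  assumes "j \<in> {0..N}" "x \<in> piece j"
  shows "infdist x (frontier T) = infdist x (frontier (piece j))"
proof (rule infdist_frontier_open_component[OF open_T bounded_T])
  have "T - piece j = (\<Union>i\<in>{0..N} - {j}. piece i)"
    using disjoint_family_onD[OF disjoint_pieces _ assms(1)] unfolding T_eq_pieces by blast
  then show "open (T - piece j)" using open_piece by auto
qed (use assms open_piece T_eq_pieces in auto)

text \<open>A point of \<open>T\<close> has distance at most \<open>g\<close> to the frontier if it lies
  in \<open>G\<close>, and at most \<open>r j\<close> times the inradius of \<open>T\<close> if it lies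
  in the copy \<open>S j ` T\<close>. As all \<open>r j\<close> are below \<open>1\<close>, the supremum
  \<open>inradius T\<close> can only obey this if it is at most \<open>g\<close>.\<close>

lemma inradius_T_le: "inradius T \<le> g"
proof (rule ccontr)
  assume "\<not> ?thesis"
  then have gR: "g < inradius T" by simp
  then have R: "0 < inradius T" using g_pos by simp
  define q where "q = Max (r ` {1..N})"
  have q: "r i \<le> q" if "i \<in> {1..N}" for i using that by (auto simp: q_def)
  have "q \<in> r ` {1..N}" unfolding q_def using N_ge_2 by (intro Max_in) auto
  then have "q < 1" using r_less_1 by auto
  have "infdist x (frontier T) \<le> max g (q * inradius T)" if x: "x \<in> T" for x
  proof -
    obtain j where j: "j \<in> {0..N}" "x \<in> piece j" using x T_eq_pieces by blast
    show ?thesis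
    proof (cases "j = 0")
      case True
      then have "x \<in> G" "infdist x (frontier T) = infdist x (frontier G)"
        using j infdist_frontier_T_piece[OF j] by (auto simp: piece_def)
      then show ?thesis
        using infdist_frontier_le_inradius[OF open_G bounded_G, of x] by (simp add: g_def)
    next
      case False
      then have jN: "j \<in> {1..N}" using j by auto
      obtain y where y: "y \<in> T" "x = S j y" using j False by (auto simp: piece_def)
      have "infdist x (frontier T) = infdist (S j y) (frontier (S j ` T))"
        using infdist_frontier_T_piece[OF j] False y by (simp add: piece_def)
      also have "\<dots> = r j * infdist y (frontier T)"
        by (simp add: frontier_similarity_image[OF similarity_S[OF jN] r_pos[OF jN]]
            infdist_similarity_image[OF similarity_S[OF jN] r_pos[OF jN]])
      also have "\<dots> \<le> q * inradius T"
        using q[OF jN] r_pos[OF jN] R infdist_frontier_le_inradius[OF open_T bounded_T y(1)]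
        by (intro mult_mono) (auto simp: infdist_nonneg)
      finally show ?thesis by simp
    qed
  qed
  then have "inradius T \<le> max g (q * inradius T)"
    using T_nonempty unfolding inradius_def[of T] by (intro cSUP_least) auto
  moreover have "q * inradius T < inradius T" using \<open>q < 1\<close> R by simp
  ultimately show False using gR by auto
qed

lemma inner_volume_T_eq_measure: "g \<le> e \<Longrightarrow> inner_volume T e = measure lebesgue T"
  using inner_volume_eq_measure[OF open_T bounded_T] inradius_T_le by simp

lemma inner_volume_S_image:
  assumes "i \<in> {1..N}"
  shows "inner_volume (S i ` T) e = r i ^ DIM('a) * inner_volume T (e / r i)"
  by (rule inner_volume_similarity_image[OF similarity_S[OF assms] r_pos[OF assms] open_T bounded_T])

lemma inner_volume_T_decomposition:
  "inner_volume T e = inner_volume G e + (\<Sum>i=1..N. inner_volume (S i ` T) e)"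
proof -
  have "inner_volume T e = (\<Sum>j\<in>{0..N}. inner_volume (piece j) e)"
    unfolding T_eq_pieces
    by (intro inner_volume_disjoint_Union open_piece bounded_piece disjoint_pieces) auto
  also have "{0..N} = insert 0 {1..N}" by auto
  finally show ?thesis by (simp add: piece_def)
qed

text \<open>In the range \<open>e > r i * g\<close>, where the volume of the \<open>i\<close>-th copy is
  not subtracted, it survives in full next to the contribution of the generator.\<close>

lemma h_eq:
  assumes "0 < e"
  shows "h e = inner_volume G e + (\<Sum>i=1..N. if r i * g < e then inner_volume (S i ` T) e else 0)"
proof -
  have "(\<Sum>i=1..N. indicator {0<..r i * g} e * inner_volume (S i ` T) e)
      + (\<Sum>i=1..N. if r i * g < e then inner_volume (S i ` T) e else 0)
      = (\<Sum>i=1..N. inner_volume (S i ` T) e)"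
    unfolding sum.distrib[symmetric] using assms by (intro sum.cong) (auto simp: indicator_def)
  then show ?thesis by (simp add: h_def inner_volume_T_decomposition[of e])
qed

lemma inner_volume_G_le_h: "0 < e \<Longrightarrow> inner_volume G e \<le> h e"
  by (simp add: h_eq inner_volume_nonneg sum_nonneg)

lemma h_nonneg: "0 < e \<Longrightarrow> 0 \<le> h e"
  using inner_volume_G_le_h[of e] inner_volume_nonneg[of G e] by linarith

lemma h_le: "h e \<le> measure lebesgue T"
proof -
  have "h e \<le> inner_volume T e" by (simp add: h_def inner_volume_nonneg sum_nonneg)
  then show ?thesis using inner_volume_le_measure[OF open_T bounded_T, of e] by linarith
qed

lemma h_ge_measure_copy:
  assumes "i \<in> {1..N}" "r i * g < e"
  shows "r i ^ DIM('a) * measure lebesgue T \<le> h e"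
proof -
  have e: "0 < e" using assms g_pos r_pos[of i] by (smt (verit) mult_pos_pos)
  have "inner_volume (S i ` T) e = r i ^ DIM('a) * measure lebesgue T"
    using inner_volume_S_image[OF assms(1)] inner_volume_T_eq_measure[of "e / r i"] assms r_pos[of i]
    by (simp add: field_simps)
  moreover have "(if r i * g < e then inner_volume (S i ` T) e else 0)
      \<le> (\<Sum>i=1..N. if r i * g < e then inner_volume (S i ` T) e else 0)"
    using assms by (intro member_le_sum) (auto simp: inner_volume_nonneg)
  ultimately show ?thesis using assms h_eq[OF e] inner_volume_nonneg[of G e] by simp
qed

lemma h_eq_inner_volume_G:
  assumes "0 < e" "\<And>i. i \<in> {1..N} \<Longrightarrow> e \<le> r i * g"
  shows "h e = inner_volume G e"
proof -
  have "(\<Sum>i=1..N. if r i * g < e then inner_volume (S i ` T) e else 0) = 0"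
    using assms(2) by (intro sum.neutral ballI) (metis not_less)
  then show ?thesis using h_eq[OF assms(1)] by simp
qed

lemma measurable_h [measurable]: "h \<in> borel_measurable borel"
proof -
  have [measurable]: "inner_volume (S i ` T) \<in> borel_measurable borel" if "i \<in> {1..N}" for i
    using that open_piece[of i] bounded_piece[of i]
    by (intro measurable_inner_volume) (auto simp: piece_def)
  have [measurable]: "inner_volume T \<in> borel_measurable borel"
    using open_T bounded_T by (rule measurable_inner_volume)
  show ?thesis unfolding h_def[abs_def] by measurable
qed

end

section \<open>The renewal equation of a tiling\<close>

locale generator_of_small_dimension = self_similar_tiling_system +
  assumes generator_dim: "rel_minkowski_dim (frontier (generator N S U)) (generator N S U) < similarity_dim N r"
begin

definition codim :: real where
  "codim = real DIM('a) - D"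

text \<open>The scaled volume of \<open>T\<close> at \<open>\<epsilon> = exp (- t)\<close>.\<close>

definition F :: "real \<Rightarrow> real" where
  "F t = exp (codim * t) * inner_volume T (exp (- t))"

text \<open>The time at which \<open>exp (- t)\<close> drops to the inradius \<open>g\<close>.\<close>

definition t0 :: real where
  "t0 = - ln g"

definition Z :: "real \<Rightarrow> real" where
  "Z t = (if t0 \<le> t then F t else 0)"

definition z :: "real \<Rightarrow> real" where
  "z t = (if t0 \<le> t then exp (codim * t) * h (exp (- t)) else 0)"

lemma codim_pos: "0 < codim"
  using dim_less by (simp add: codim_def D_def)

lemma exp_le_g_iff: "exp (- t) \<le> g \<longleftrightarrow> t0 \<le> t"
  using ln_le_cancel_iff[of "exp (- t)" g] g_pos by (auto simp: t0_def)

lemma exp_image_Ici: "(\<lambda>t. exp (- t)) ` {t0..} = {0<..g}"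
proof -
  have "e \<in> (\<lambda>t. exp (- t)) ` {t0..}" if "0 < e" "e \<le> g" for e
    using that exp_le_g_iff[of "- ln e"] by (intro image_eqI[of _ _ "- ln e"]) auto
  then show ?thesis using exp_le_g_iff by auto
qed

lemma exp_image_Icc: "(\<lambda>t. exp (- t)) ` {0..b} = {exp (- b)..1}" for b :: real
proof -
  have "e \<in> (\<lambda>t. exp (- t)) ` {0..b}" if "exp (- b) \<le> e" "e \<le> 1" for e
  proof -
    have "0 < e" using that exp_gt_zero[of "- b"] by linarith
    moreover from this have "- b \<le> ln e" using that by (simp add: ln_ge_iff)
    ultimately show ?thesis using that by (intro image_eqI[of _ _ "- ln e"]) auto
  qed
  then show ?thesis by auto
qed

lemma measurable_F [measurable]: "F \<in> borel_measurable borel"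
proof -
  note [measurable] = measurable_inner_volume[OF open_T bounded_T]
  show ?thesis unfolding F_def[abs_def] by measurable
qed

lemma measurable_z [measurable]: "z \<in> borel_measurable borel"
  unfolding z_def[abs_def] by measurable

lemma F_nonneg: "0 \<le> F t"
  by (simp add: F_def inner_volume_nonneg)

lemma F_le: "t \<le> b \<Longrightarrow> F t \<le> exp (codim * b) * measure lebesgue T"
  unfolding F_def using codim_pos inner_volume_le_measure[OF open_T bounded_T]
  by (intro mult_mono) (auto simp: inner_volume_nonneg)

text \<open>The volume decreases in \<open>t\<close>, so \<open>F\<close> can grow no faster than its
  exponential factor.\<close>

lemma F_growth: "0 \<le> s \<Longrightarrow> F (t + s) \<le> exp (codim * s) * F t"
proof -
  assume "0 \<le> s"
  then have "inner_volume T (exp (- (t + s))) \<le> inner_volume T (exp (- t))"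
    by (intro inner_volume_mono open_T bounded_T) simp
  then have "exp (codim * (t + s)) * inner_volume T (exp (- (t + s)))
      \<le> exp (codim * (t + s)) * inner_volume T (exp (- t))" by simp
  moreover have "exp (codim * (t + s)) = exp (codim * s) * exp (codim * t)"
    by (simp add: distrib_left exp_add)
  ultimately show ?thesis by (simp add: F_def mult.assoc)
qed

lemma set_integrable_F: "bounded A \<Longrightarrow> A \<in> sets borel \<Longrightarrow> set_integrable lborel A F"
proof -
  assume A: "bounded A" "A \<in> sets borel"
  then obtain b where b: "\<And>t. t \<in> A \<Longrightarrow> t \<le> b"
    using bounded_imp_bdd_above[OF A(1)] by (auto simp: bdd_above_def)
  then show ?thesis
    using A F_le F_nonneg
    by (intro bounded_measurable_set_integrable[where C = "exp (codim * b) * measure lebesgue T"]) auto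
qed

text \<open>Shifting \<open>t\<close> by \<open>ln (r i)\<close> divides \<open>\<epsilon>\<close> by
  \<open>r i\<close>; the weight \<open>r i powr D\<close> and the change of the exponential factor
  combine to \<open>r i ^ d\<close>, the scaling of volume under \<open>S i\<close>.\<close>

lemma F_shift:
  assumes i: "i \<in> {1..N}"
  shows "r i powr D * F (t - - ln (r i)) = exp (codim * t) * inner_volume (S i ` T) (exp (- t))"
proof -
  have arg: "exp (- (t - - ln (r i))) = exp (- t) / r i"
    using r_pos[OF i] by (simp add: exp_add exp_diff exp_minus field_simps)
  have factor: "r i powr D * exp (codim * (t - - ln (r i))) = r i ^ DIM('a) * exp (codim * t)"
  proof -
    have "r i powr D * exp (codim * (t - - ln (r i))) = exp (D * ln (r i) + codim * (t + ln (r i)))"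
      using r_pos[OF i] by (simp add: powr_def exp_add)
    also have "D * ln (r i) + codim * (t + ln (r i)) = real DIM('a) * ln (r i) + codim * t"
      by (simp add: codim_def algebra_simps)
    also have "exp (\<dots>) = r i powr real DIM('a) * exp (codim * t)"
      using r_pos[OF i] by (simp add: powr_def exp_add)
    finally show ?thesis using r_pos[OF i] by (simp add: powr_realpow)
  qed
  have "r i powr D * F (t - - ln (r i))
      = (r i powr D * exp (codim * (t - - ln (r i)))) * inner_volume T (exp (- t) / r i)"
    unfolding F_def arg by (simp only: mult.assoc)
  also have "\<dots> = exp (codim * t) * (r i ^ DIM('a) * inner_volume T (exp (- t) / r i))"
    unfolding factor by (simp only: mult_ac)
  finally show ?thesis unfolding inner_volume_S_image[OF i] .
qed

text \<open>The indicator functions in \<open>h\<close> match the truncation of \<open>Z\<close>: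
  \<open>\<epsilon> \<le> r i * g\<close> means that the shifted time \<open>t + ln (r i)\<close> has
  passed \<open>t0\<close>.\<close>

lemma Z_renewal: "Z t = z t + (\<Sum>i=1..N. r i powr D * Z (t - - ln (r i)))"
proof (cases "t0 \<le> t")
  case True
  have "r i powr D * Z (t - - ln (r i))
      = exp (codim * t) * (indicator {0<..r i * g} (exp (- t)) * inner_volume (S i ` T) (exp (- t)))"
    if i: "i \<in> {1..N}" for i
  proof -
    have "exp (- t) \<le> r i * g \<longleftrightarrow> exp (- (t - - ln (r i))) \<le> g"
      using r_pos[OF i] by (simp add: exp_add exp_diff exp_minus field_simps)
    then have "exp (- t) \<in> {0<..r i * g} \<longleftrightarrow> t0 \<le> t - - ln (r i)"
      using exp_le_g_iff[of "t - - ln (r i)"] by simp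
    then show ?thesis using F_shift[OF i, of t] by (auto simp: Z_def indicator_def)
  qed
  then have "(\<Sum>i=1..N. r i powr D * Z (t - - ln (r i)))
      = exp (codim * t) * (\<Sum>i=1..N. indicator {0<..r i * g} (exp (- t)) * inner_volume (S i ` T) (exp (- t)))"
    unfolding sum_distrib_left by (intro sum.cong) auto
  moreover have "Z t = F t" "z t = exp (codim * t) * h (exp (- t))"
    using True by (simp_all add: Z_def z_def)
  ultimately show ?thesis unfolding F_def h_def right_diff_distrib by linarith
next
  case False
  have "Z (t - - ln (r i)) = 0" if i: "i \<in> {1..N}" for i
    using False ln_less_zero[OF r_pos[OF i] r_less_1[OF i]] by (simp add: Z_def)
  then have "(\<Sum>i=1..N. r i powr D * Z (t - - ln (r i))) = 0"
    by (intro sum.neutral ballI) (simp only: mult_zero_right)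
  moreover have "Z t = 0" "z t = 0" using False by (auto simp: Z_def z_def)
  ultimately show ?thesis by linarith
qed

lemma z_nonneg: "0 \<le> z t"
  by (simp add: z_def h_nonneg)

text \<open>Once \<open>\<epsilon>\<close> is below all \<open>r i * g\<close>, only the generator is
  left in \<open>h\<close>, and its volume decays with an exponent belonging to some \<open>s <
  D\<close>.\<close>

lemma z_decay: "\<exists>c>0. \<exists>b. \<forall>t\<ge>b. z t \<le> exp (- c * t)"
proof -
  have "rel_minkowski_dim (frontier G) G < D"
    using generator_dim unfolding G_def D_def .
  from inner_volume_decay_from_dimension[OF open_G bounded_G G_nonempty this]
  obtain s \<epsilon>0 where s: "s < D" "0 < \<epsilon>0"
    "\<And>e. 0 < e \<Longrightarrow> e < \<epsilon>0 \<Longrightarrow> inner_volume G e \<le> e powr (real DIM('a) - s)"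
    by auto
  define q where "q = Min (insert \<epsilon>0 ((\<lambda>i. r i * g) ` {1..N}))"
  have q: "0 < q" "q \<le> \<epsilon>0"
    unfolding q_def using s(2) g_pos r_pos by (auto simp: Min_gr_iff)
  have q_le: "q \<le> r i * g" if "i \<in> {1..N}" for i
    unfolding q_def using that by (intro Min_le) auto
  \<comment> \<open>The summand \<open>1\<close> makes \<open>exp (- t)\<close> strictly smaller than \<open>q\<close>, as the bound from \<open>\<epsilon>0\<close> requires.\<close>
  have "z t \<le> exp (- (D - s) * t)" if t: "1 - ln q \<le> t" for t
  proof (cases "t0 \<le> t")
    case True
    have "exp (- t) < exp (ln q)" using t by (simp only: exp_less_cancel_iff)
    then have e: "exp (- t) < q" using q(1) by simp
    have "h (exp (- t)) = inner_volume G (exp (- t))"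
      using e q_le by (intro h_eq_inner_volume_G) force+
    also have "\<dots> \<le> exp (- t) powr (real DIM('a) - s)" using e q(2) by (intro s(3)) auto
    also have "\<dots> = exp (- t * (real DIM('a) - s))" by (simp add: powr_def mult.commute)
    finally have "z t \<le> exp (codim * t) * exp (- t * (real DIM('a) - s))"
      using True by (simp add: z_def)
    also have "\<dots> = exp (- (D - s) * t)"
      unfolding exp_add[symmetric] by (simp add: codim_def algebra_simps)
    finally show ?thesis .
  qed (simp add: z_def)
  with s(1) show ?thesis by (intro exI[of _ "D - s"]) auto
qed

lemma integrable_z: "integrable lborel z"
proof -
  obtain c b where c: "0 < c" "\<And>t. b \<le> t \<Longrightarrow> z t \<le> exp (- c * t)" using z_decay by blast
  have "set_integrable lborel {b..} z"
  proof (rule set_integrable_bound[OF set_integrable_exp_decay[OF c(1)]])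
    show "set_borel_measurable lborel {b..} z" by (simp add: set_borel_measurable_def)
    show "AE t in lborel. t \<in> {b..} \<longrightarrow> norm (z t) \<le> norm (exp (- c * t))"
      using c(2) z_nonneg by (intro AE_I2) auto
  qed
  moreover have "set_integrable lborel {t0..<b} z"
  proof (rule bounded_measurable_set_integrable[where C = "exp (codim * b) * measure lebesgue T"])
    show "\<bar>z t\<bar> \<le> exp (codim * b) * measure lebesgue T" if "t \<in> {t0..<b}" for t
    proof -
      have "exp (codim * t) * h (exp (- t)) \<le> exp (codim * b) * measure lebesgue T"
        using that codim_pos h_le h_nonneg by (intro mult_mono) auto
      then show ?thesis using that z_nonneg[of t] by (simp add: z_def)
    qed
  qed auto
  ultimately have "set_integrable lborel ({b..} \<union> {t0..<b}) z"
    by (rule set_integrable_Un) auto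
  moreover have "z = (\<lambda>t. indicator ({b..} \<union> {t0..<b}) t *\<^sub>R z t)"
    by (auto simp: fun_eq_iff indicator_def z_def)
  ultimately show ?thesis by (simp add: set_integrable_def)
qed

lemma z_tendsto_0: "(z \<longlongrightarrow> 0) at_top"
proof -
  obtain c b where c: "0 < c" "\<And>t. b \<le> t \<Longrightarrow> z t \<le> exp (- c * t)" using z_decay by blast
  have "filterlim (\<lambda>t. - c * t) at_bot at_top"
    using c by (intro filterlim_tendsto_neg_mult_at_bot[OF tendsto_const _ filterlim_ident]) auto
  then have lim: "((\<lambda>t. exp (- c * t)) \<longlongrightarrow> 0) at_top" by (rule filterlim_compose[OF exp_at_bot])
  show ?thesis
  proof (rule tendsto_sandwich[OF _ _ tendsto_const lim])
    show "\<forall>\<^sub>F t in at_top. 0 \<le> z t" using z_nonneg by simp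
    show "\<forall>\<^sub>F t in at_top. z t \<le> exp (- c * t)"
      using eventually_ge_at_top[of b] by (rule eventually_mono) (rule c(2))
  qed
qed

lemma set_integrable_Z: "set_integrable lborel {..t} Z"
proof -
  have "(\<lambda>u. indicator {..t} u *\<^sub>R Z u) = (\<lambda>u. indicator {t0..t} u *\<^sub>R F u)"
    by (auto simp: fun_eq_iff indicator_def Z_def)
  then show ?thesis using set_integrable_F[of "{t0..t}"] by (simp add: set_integrable_def)
qed

sublocale renewal_equation "{1..N}" "\<lambda>i. r i powr D" "\<lambda>i. - ln (r i)" Z z
proof
  show "0 < r i powr D" "0 < - ln (r i)" if "i \<in> {1..N}" for i
    using r_pos[OF that] r_less_1[OF that] by auto
  show "(\<Sum>i\<in>{1..N}. r i powr D) = 1" by (rule sum_ratio_powr_D)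
  show "0 \<le> Z t" for t by (simp add: Z_def F_nonneg)
  show "Z t = z t + (\<Sum>i\<in>{1..N}. r i powr D * Z (t - - ln (r i)))" for t by (rule Z_renewal)
  show "finite {1..N}" by simp
  show "set_integrable lborel {..t} Z" for t by (rule set_integrable_Z)
  show "integrable lborel z" by (rule integrable_z)
qed

lemma mean_step_eq: "mean_step = - (\<Sum>i=1..N. r i powr D * ln (r i))"
  unfolding mean_step_def mult_minus_right sum_negf ..

lemma
  shows set_integrable_generator_integrand:
      "set_integrable lborel {0<..g} (\<lambda>e. e powr (D - real DIM('a) - 1) * h e)"
    and generator_integral_eq:
      "(LINT e:{0<..g}|lborel. e powr (D - real DIM('a) - 1) * h e) = (LINT t|lborel. z t)"
proof -
  let ?f = "\<lambda>e. e powr (D - real DIM('a) - 1) * h e"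
  have z: "indicator {t0..} t *\<^sub>R (exp (- t) * ?f (exp (- t))) = z t" for t
  proof -
    have "exp (- t) * exp (- t) powr (D - real DIM('a) - 1) = exp (codim * t)"
      by (simp add: powr_def exp_add[symmetric] codim_def algebra_simps)
    then show ?thesis by (simp add: z_def mult.assoc[symmetric] indicator_def)
  qed
  have int: "set_integrable lborel {t0..} (\<lambda>t. exp (- t) * ?f (exp (- t)))"
    unfolding set_integrable_def z by (rule integrable_z)
  have meas: "?f \<in> borel_measurable borel" by measurable
  show "set_integrable lborel {0<..g} ?f"
    using set_integrable_exp_substitution[OF meas _ _ int] by (simp add: exp_image_Ici)
  have "(LINT e:{0<..g}|lborel. ?f e) = (LINT t:{t0..}|lborel. exp (- t) * ?f (exp (- t)))"
    using set_integral_exp_substitution[OF meas _ _ int] by (simp add: exp_image_Ici)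
  also have "\<dots> = (LINT t|lborel. z t)" unfolding set_lebesgue_integral_def z ..
  finally show "(LINT e:{0<..g}|lborel. ?f e) = (LINT t|lborel. z t)" .
qed

lemma renewal_limit_eq:
  "renewal_limit = 1 / mean_step * (LINT e:{0<..g}|lborel. e powr (D - real DIM('a) - 1) * h e)"
  unfolding renewal_limit_def generator_integral_eq by simp

lemma renewal_limit_pos: "0 < renewal_limit"
proof -
  have i: "1 \<in> {1..N}" using N_ge_2 by simp
  define k where "k = exp (codim * t0) * (r 1 ^ DIM('a) * measure lebesgue T)"
  have k: "0 < k" using r_pos[OF i] measure_T_pos by (simp add: k_def)
  define t1 where "t1 = t0 - ln (r 1)"
  have t1: "t0 < t1" using r_pos[OF i] r_less_1[OF i] by (simp add: t1_def)
  \<comment> \<open>While \<open>r 1 * g < e \<le> g\<close>, the first copy of \<open>T\<close> is no longer subtracted in \<open>h\<close> and contributes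
    its full volume.\<close>
  have le: "indicator {t0..<t1} t * k \<le> z t" for t
  proof (cases "t \<in> {t0..<t1}")
    case True
    have "r 1 * g < exp (- t)"
    proof -
      have "exp (- t1) < exp (- t)" using True by simp
      moreover have "exp (- t1) = r 1 * g"
        using r_pos[OF i] g_pos by (simp add: t1_def t0_def exp_add exp_diff exp_minus field_simps)
      ultimately show ?thesis by simp
    qed
    then have "r 1 ^ DIM('a) * measure lebesgue T \<le> h (exp (- t))" by (rule h_ge_measure_copy[OF i])
    then have "k \<le> exp (codim * t) * h (exp (- t))"
      unfolding k_def using True codim_pos r_pos[OF i] by (intro mult_mono) auto
    then show ?thesis using True by (simp add: z_def)
  qed (simp add: z_nonneg)
  have "0 < (t1 - t0) * k" using t1 k by simp
  also have "\<dots> = (LINT t|lborel. indicator {t0..<t1} t * k)" using t1 by simp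
  also have "\<dots> \<le> (LINT t|lborel. z t)"
    using le integrable_z less_imp_le[OF t1]
    by (intro integral_mono) (auto intro!: integrable_real_indicator)
  finally show ?thesis unfolding renewal_limit_def using mean_step_pos by (rule divide_pos_pos)
qed

lemma scaled_volume_eq_F: "scaled_volume D (frontier T) T (exp (- t)) = F t"
proof -
  have "exp (- t) powr (D - real DIM('a)) = exp (codim * t)"
    by (simp add: powr_def codim_def algebra_simps)
  then show ?thesis by (simp add: scaled_volume_eq_inner_volume[OF bounded_T T_nonempty] F_def)
qed

lemma neg_ln_at_top: "filterlim (\<lambda>\<delta>. - ln \<delta>) at_top (at_right (0::real))"
  using ln_at_0 by (simp add: filterlim_uminus_at_top)

text \<open>The integrals of \<open>F\<close> from \<open>0\<close> and from \<open>t0\<close> differ by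
  a constant, which disappears when dividing by \<open>t\<close>. Starting both at \<open>min 0
  t0\<close> avoids distinguishing the sign of \<open>t0\<close>.\<close>

lemma integral_F_eq_cumulative:
  "\<exists>c. \<forall>t. 0 \<le> t \<longrightarrow> t0 \<le> t \<longrightarrow> (LINT u:{0..t}|lborel. F u) = cumulative t + c"
proof -
  define m where "m = min 0 t0"
  have split: "(LINT u:{m..t}|lborel. F u) = (LINT u:{m..<s}|lborel. F u) + (LINT u:{s..t}|lborel. F u)"
    if "m \<le> s" "s \<le> t" for s t
  proof -
    have "{m..t} = {m..<s} \<union> {s..t}" using that by auto
    moreover have "{m..<s} \<inter> {s..t} = {}" by auto
    ultimately show ?thesis using set_integrable_F by (simp add: set_integral_Un)
  qed
  have cum: "cumulative t = (LINT u:{t0..t}|lborel. F u)" for t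
    unfolding cumulative_def set_lebesgue_integral_def
    by (intro Bochner_Integration.integral_cong) (auto simp: indicator_def Z_def)
  have "(LINT u:{0..t}|lborel. F u)
      = cumulative t + ((LINT u:{m..<t0}|lborel. F u) - (LINT u:{m..<0}|lborel. F u))"
    if "0 \<le> t" "t0 \<le> t" for t
    using split[of 0 t] split[of t0 t] that by (simp add: m_def cum)
  then show ?thesis by blast
qed

lemma average_content: "has_average_minkowski_content D (frontier T) T renewal_limit"
proof -
  obtain c where c: "\<And>t. 0 \<le> t \<Longrightarrow> t0 \<le> t \<Longrightarrow> (LINT u:{0..t}|lborel. F u) = cumulative t + c"
    using integral_F_eq_cumulative by blast
  let ?v = "scaled_volume D (frontier T) T"
  have subst: "(LINT e:{exp (- t)..1}|lborel. ?v e / e) = (LINT u:{0..t}|lborel. F u)" for t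
  proof -
    have [measurable]: "inner_volume T \<in> borel_measurable borel"
      using open_T bounded_T by (rule measurable_inner_volume)
    have meas: "(\<lambda>e. ?v e / e) \<in> borel_measurable borel"
      unfolding scaled_volume_eq_inner_volume[OF bounded_T T_nonempty] by measurable
    have F: "exp (- u) * (?v (exp (- u)) / exp (- u)) = F u" for u
      by (simp add: scaled_volume_eq_F)
    show ?thesis
      using set_integral_exp_substitution[OF meas, of "{0..t}"] set_integrable_F[of "{0..t}"]
      unfolding F exp_image_Icc by simp
  qed
  have "((\<lambda>t. cumulative t / t + c / t) \<longlongrightarrow> renewal_limit + 0) at_top"
    by (intro tendsto_add average_tendsto tendsto_divide_0[OF tendsto_const]
        filterlim_at_top_imp_at_infinity filterlim_ident)
  then have "((\<lambda>\<delta>. cumulative (- ln \<delta>) / (- ln \<delta>) + c / (- ln \<delta>)) \<longlongrightarrow> renewal_limit + 0) (at_right 0)"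
    using neg_ln_at_top by (rule filterlim_compose)
  then have "((\<lambda>\<delta>. cumulative (- ln \<delta>) / (- ln \<delta>) + c / (- ln \<delta>)) \<longlongrightarrow> renewal_limit) (at_right 0)"
    by (simp only: add_0_right)
  moreover have "\<forall>\<^sub>F \<delta> in at_right 0. cumulative (- ln \<delta>) / (- ln \<delta>) + c / (- ln \<delta>)
      = 1 / \<bar>ln \<delta>\<bar> * (LINT e:{\<delta>..1}|lborel. ?v e / e)"
    using eventually_at_right_less[of 0]
      neg_ln_at_top[THEN filterlim_at_top[THEN iffD1, rule_format], of "max 0 t0"]
  proof eventually_elim
    case (elim \<delta>)
    then have "(LINT e:{\<delta>..1}|lborel. ?v e / e) = cumulative (- ln \<delta>) + c"
      using subst[of "- ln \<delta>"] c[of "- ln \<delta>"] by simp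
    moreover have "\<bar>ln \<delta>\<bar> = - ln \<delta>" using elim by simp
    ultimately show ?case by (simp add: add_divide_distrib)
  qed
  ultimately show ?thesis
    unfolding has_average_minkowski_content_def by (rule Lim_transform_eventually)
qed

text \<open>The steps \<open>- ln (r i)\<close> generate the same group as the logarithms of the
  ratios.\<close>

lemma content_if_nonlattice:
  assumes "nonlattice N r"
  shows "has_minkowski_content D (frontier T) T renewal_limit"
proof -
  have "(\<lambda>i. - ln (r i)) ` {1..N} = uminus ` (\<lambda>i. ln (r i)) ` {1..N}" by (simp add: image_image)
  have gc: "group_closure (uminus ` A) \<subseteq> group_closure A" for A :: "real set"
  proof
    fix x assume "x \<in> group_closure (uminus ` A)"
    then show "x \<in> group_closure A"
      by (induction rule: group_closure.induct) (auto intro: group_closure.intros)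
  qed
  have eq: "group_closure (uminus ` A) = group_closure A" for A :: "real set"
    using gc[of A] gc[of "uminus ` A"] by (simp add: image_image)
  have dense: "\<not> discrete (group_closure ((\<lambda>i. - ln (r i)) ` {1..N}))"
    using assms eq[of "(\<lambda>i. ln (r i)) ` {1..N}"] by (simp add: nonlattice_def image_image)
  have "(Z \<longlongrightarrow> renewal_limit) at_top"
  proof (rule limit_if_steps_dense[OF dense z_tendsto_0])
    show "0 \<le> codim" using codim_pos by simp
    show "Z (t + s) \<le> exp (codim * s) * Z t" if "t0 \<le> t" "0 \<le> s" for t s
      using that F_growth[of s t] by (simp add: Z_def)
  qed
  then have "((\<lambda>\<delta>. Z (- ln \<delta>)) \<longlongrightarrow> renewal_limit) (at_right 0)"
    using neg_ln_at_top by (rule filterlim_compose)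
  moreover have "\<forall>\<^sub>F \<delta> in at_right 0. Z (- ln \<delta>) = scaled_volume D (frontier T) T \<delta>"
    using eventually_at_right_less[of 0]
      neg_ln_at_top[THEN filterlim_at_top[THEN iffD1, rule_format], of t0]
  proof eventually_elim
    case (elim \<delta>)
    then show ?case using scaled_volume_eq_F[of "- ln \<delta>"] by (simp add: Z_def)
  qed
  ultimately show ?thesis
    unfolding has_minkowski_content_def by (rule Lim_transform_eventually)
qed

end

section \<open>Minkowski contents of the tiling\<close>

theorem theorem3p2:
  fixes N :: nat
    and S :: "nat \<Rightarrow> 'a::euclidean_space \<Rightarrow> 'a"
    and r :: "nat \<Rightarrow> real"
    and U G T :: "'a set"
    and D g \<eta> :: real
    and h :: "real \<Rightarrow> real"
  assumes "IFS N S r"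
    and "feasible_open_set N S U"
    and "D = similarity_dim N r"
    and "D < real DIM('a)"
    and "G = generator N S U"
    and "g = inradius G"
    and "T = \<Union> (self_similar_tiling N S U)"
    and "rel_minkowski_dim (frontier G) G < D"
    and "\<eta> = - (\<Sum>i=1..N. r i powr D * ln (r i))"
    and "\<And>\<epsilon>. \<epsilon> > 0 \<Longrightarrow> h \<epsilon> = inner_volume T \<epsilon>
           - (\<Sum>i=1..N. indicator {0<..r i * g} \<epsilon> * inner_volume (S i ` T) \<epsilon>)"
  defines "M \<equiv> 1 / \<eta> * (LINT \<epsilon>:{0<..g}|lborel. \<epsilon> powr (D - real DIM('a) - 1) * h \<epsilon>)"
  shows "set_integrable lborel {0<..g} (\<lambda>\<epsilon>. \<epsilon> powr (D - real DIM('a) - 1) * h \<epsilon>)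
    \<and> has_average_minkowski_content D (frontier T) T M
    \<and> 0 < M
    \<and> (nonlattice N r \<longrightarrow> has_minkowski_content D (frontier T) T M)"
proof -
  interpret X: generator_of_small_dimension N S r U
    using assms(1-8) by unfold_locales auto
  have D: "X.D = D" and G: "X.G = G" and T: "X.T = T"
    using assms by (simp_all add: X.D_def X.G_def X.T_def)
  have g: "X.g = g" using assms(6) by (simp add: X.g_def G)
  have \<eta>: "X.mean_step = \<eta>" using X.mean_step_eq unfolding D assms(9) .
  have h: "h e = X.h e" if "0 < e" for e
    using assms(10)[OF that] by (simp add: X.h_def T g)
  have int: "set_integrable lborel {0<..g} (\<lambda>e. e powr (D - real DIM('a) - 1) * h e)"
  proof -
    have "set_integrable lborel {0<..g} (\<lambda>e. e powr (D - real DIM('a) - 1) * h e)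
        \<longleftrightarrow> set_integrable lborel {0<..g} (\<lambda>e. e powr (D - real DIM('a) - 1) * X.h e)"
      by (intro set_integrable_cong) (auto simp: h)
    then show ?thesis using X.set_integrable_generator_integrand by (simp add: D g)
  qed
  have "(LINT e:{0<..g}|lborel. e powr (D - real DIM('a) - 1) * h e)
      = (LINT e:{0<..g}|lborel. e powr (D - real DIM('a) - 1) * X.h e)"
    by (intro set_lebesgue_integral_cong) (auto simp: h)
  then have M: "M = X.renewal_limit"
    unfolding M_def X.renewal_limit_eq unfolding \<eta> unfolding D g by (rule arg_cong)
  have "has_average_minkowski_content D (frontier T) T M"
    using X.average_content unfolding M[symmetric] unfolding D T .
  moreover have "0 < M" unfolding M by (rule X.renewal_limit_pos)
  moreover have "has_minkowski_content D (frontier T) T M" if "nonlattice N r"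
    using X.content_if_nonlattice[OF that] unfolding M[symmetric] unfolding D T .
  ultimately show ?thesis using int by blast
qed

end
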